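(* Let $A=\langle a,b\rangle$ be a monogenic orthodox semigroup (so $A$ is an orthodox semigroup generated, as a semigroup, by a pair of mutually inverse elements $a$ and $b$) such that $a$ (and hence $b$) has infinite order. Then $A$ is torsion-free and any semigroup lattice isomorphic to $A$ is a torsion-free monogenic orthodox semigroup. Thus the class of all monogenic orthodox semigroups whose generators have infinite order is lattice closed, and every semigroup in that class is torsion-free.
   Context: A semigroup $S$ is regular if for every $x\in S$ there is $x'\in S$ with $xx'x=x$. Elements $x,y\in S$ are mutually inverse if $xyx=x$ and $yxy=y$. An orthodox semigroup is a regular semigroup whose idempotents form a subsemigroup. A monogenic orthodox semigroup is an orthodox semigroup generated (as a semigroup) by a pair of mutually inverse elements; "generators" refers to such a pair of mutually inverse generating elements. An element $x$ of a semigroup has infinite order if the cyclic subsemigroup $\langle x\rangle=\{x^n : n\geq 1\}$ is infinite. A semigroup is torsion-free if every nonidempotent element of it has infinite order. For a semigroup $S$, $\operatorname{Sub}(S)$ denotes the lattice (under inclusion) of all subsemigroups of $S$, where by convention the empty set is counted as a subsemigroup. Two semigroups $S$ and $T$ are lattice isomorphic if $\operatorname{Sub}(S)\cong\operatorname{Sub}(T)$. A class $\mathcal{K}$ of semigroups is lattice closed (in the class of all semigroups) if $\mathcal{K}$ contains every semigroup which is lattice isomorphic to some semigroup belonging to $\mathcal{K}$. *)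

theory Defs
  imports "HOL-Algebra.Congruence" "HOL.Hull"
begin

record 'a magma = "'a partial_object" +
  smult :: "'a \<Rightarrow> 'a \<Rightarrow> 'a"  (infixl "\<cdot>\<index>" 70)

text \<open>The library's \<open>semigroup\<close> lives on a whole type; here the carrier is explicit.\<close>

locale carrier_semigroup =
  fixes S :: "'a magma" (structure)
  assumes closed: "\<lbrakk>x \<in> carrier S; y \<in> carrier S\<rbrakk> \<Longrightarrow> x \<cdot> y \<in> carrier S"
    and assoc: "\<lbrakk>x \<in> carrier S; y \<in> carrier S; z \<in> carrier S\<rbrakk> \<Longrightarrow> (x \<cdot> y) \<cdot> z = x \<cdot> (y \<cdot> z)"

text \<open>The empty set counts as a subsemigroup.\<close>

definition subsemigroup :: "'a magma \<Rightarrow> 'a set \<Rightarrow> bool" where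
  "subsemigroup S H \<longleftrightarrow> H \<subseteq> carrier S \<and> (\<forall>x\<in>H. \<forall>y\<in>H. x \<cdot>\<^bsub>S\<^esub> y \<in> H)"

definition Sub :: "'a magma \<Rightarrow> 'a set set" where
  "Sub S = {H. subsemigroup S H}"

definition generated :: "'a magma \<Rightarrow> 'a set \<Rightarrow> 'a set" where
  "generated S X = subsemigroup S hull X"

definition idempotent :: "'a magma \<Rightarrow> 'a \<Rightarrow> bool" where
  "idempotent S e \<longleftrightarrow> e \<in> carrier S \<and> e \<cdot>\<^bsub>S\<^esub> e = e"

definition mutually_inverse :: "'a magma \<Rightarrow> 'a \<Rightarrow> 'a \<Rightarrow> bool" where
  "mutually_inverse S x y \<longleftrightarrow> x \<in> carrier S \<and> y \<in> carrier S \<and>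
     x \<cdot>\<^bsub>S\<^esub> y \<cdot>\<^bsub>S\<^esub> x = x \<and> y \<cdot>\<^bsub>S\<^esub> x \<cdot>\<^bsub>S\<^esub> y = y"

definition regular_semigroup :: "'a magma \<Rightarrow> bool" where
  "regular_semigroup S \<longleftrightarrow> carrier_semigroup S \<and>
     (\<forall>x\<in>carrier S. \<exists>x'\<in>carrier S. x \<cdot>\<^bsub>S\<^esub> x' \<cdot>\<^bsub>S\<^esub> x = x)"

definition orthodox_semigroup :: "'a magma \<Rightarrow> bool" where
  "orthodox_semigroup S \<longleftrightarrow> regular_semigroup S \<and> subsemigroup S {e. idempotent S e}"

definition monogenic_orthodox_with :: "'a magma \<Rightarrow> 'a \<Rightarrow> 'a \<Rightarrow> bool" where
  "monogenic_orthodox_with S a b \<longleftrightarrow> orthodox_semigroup S \<and> mutually_inverse S a b \<and>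
     generated S {a, b} = carrier S"

definition monogenic_orthodox :: "'a magma \<Rightarrow> bool" where
  "monogenic_orthodox S \<longleftrightarrow> (\<exists>a b. monogenic_orthodox_with S a b)"

text \<open>Only exponents \<open>n \<ge> 1\<close> are meaningful, since there is no identity element.\<close>

definition spow :: "'a magma \<Rightarrow> 'a \<Rightarrow> nat \<Rightarrow> 'a" where
  "spow S x n = ((\<lambda>y. y \<cdot>\<^bsub>S\<^esub> x) ^^ (n - 1)) x"

definition infinite_order :: "'a magma \<Rightarrow> 'a \<Rightarrow> bool" where
  "infinite_order S x \<longleftrightarrow> infinite {spow S x n | n. n \<ge> 1}"

definition torsion_free :: "'a magma \<Rightarrow> bool" where
  "torsion_free S \<longleftrightarrow> (\<forall>x\<in>carrier S. \<not> idempotent S x \<longrightarrow> infinite_order S x)"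

definition monogenic_orthodox_inf :: "'a magma \<Rightarrow> bool" where
  "monogenic_orthodox_inf S \<longleftrightarrow>
     (\<exists>a b. monogenic_orthodox_with S a b \<and> infinite_order S a \<and> infinite_order S b)"

text \<open>An order isomorphism for inclusion is the same as a lattice isomorphism, since meets and
  joins are determined by the order.\<close>

definition lattice_isomorphic :: "'a magma \<Rightarrow> 'b magma \<Rightarrow> bool" where
  "lattice_isomorphic S T \<longleftrightarrow>
     (\<exists>f. bij_betw f (Sub S) (Sub T) \<and> (\<forall>X\<in>Sub S. \<forall>Y\<in>Sub S. X \<subseteq> Y \<longleftrightarrow> f X \<subseteq> f Y))"

end

theory Submission
  imports Defs
begin

text \<open>
  A word in \<open>a\<close> and \<open>b\<close> has a degree, counting \<open>a\<close> as \<open>1\<close> and \<open>b\<close> as \<open>-1\<close>. If \<open>a\<close> has infinite order, the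
  degree only depends on the element represented, and the elements of degree \<open>0\<close> are exactly the
  idempotents; hence \<open>A\<close> is torsion-free. Then a monogenic subsemigroup has a greatest proper
  subsemigroup and a unique generator, so that a lattice isomorphism onto \<open>Sub T\<close> is induced by a
  bijection \<open>\<phi>\<close> that commutes with taking generated subsemigroups. It maps idempotents to
  idempotents and transports the sign of the degree to \<open>T\<close>.

  A product of a positive and a negative element of \<open>T\<close> is compared with the idempotents that the two
  elements generate; this yields that \<open>\<phi> a \<phi> b\<close> and \<open>\<phi> b \<phi> a\<close> are idempotent. That \<open>\<phi> a\<close> and \<open>\<phi> b\<close> are
  mutually inverse is shown in two cases, according to whether \<open>ab\<close> lies in the ideal generated by
  \<open>a\<^sup>2\<close>. If not, \<open>ab\<close> and \<open>ba\<close> are singled out in the lattice. If so, \<open>ab\<close> and \<open>ba\<close> are comparable, which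
  produces a submonoid generated by mutually inverse elements whose image is regular.
\<close>

section \<open>Generated subsemigroups and words\<close>

text \<open>The obstacle is that \<open>\<phi>\<close> need not be a homomorphism. All that is known
  of \<open>s \<star> t\<close> is that its preimage is some word in the preimages of
  \<open>s\<close> and \<open>t\<close>, so the degree is not known to be additive on
  \<open>T\<close>, nor \<open>T\<close> to be regular. What survives: words in elements of one sign
  keep that sign, elements of finite order are idempotent, and for opposite signs suitable powers
  have a product of degree \<open>0\<close> in \<open>A\<close>. The danger is an idempotent of
  \<open>T\<close> that absorbs an element of nonzero degree; it would be a zero of
  \<open>T\<close>, while its preimage would be an identity of \<open>A\<close>, and this is
  contradictory. Regularity enters through \<open>regular_imp_inverse\<close>: if
  \<open>\<phi> a\<close> has some \<open>z\<close> with
  \<open>\<phi> a \<star> z \<star> \<phi> a = \<phi> a\<close>, then \<open>\<phi> b\<close> can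
  take the place of \<open>z\<close>. Negating the degree swaps \<open>a\<close> and
  \<open>b\<close>, so most statements need a proof for one sign only.\<close>

inductive_set gen :: "('a \<Rightarrow> 'a \<Rightarrow> 'a) \<Rightarrow> 'a set \<Rightarrow> 'a set" for m X where
  gen_base: "x \<in> X \<Longrightarrow> x \<in> gen m X"
| gen_mult: "x \<in> gen m X \<Longrightarrow> y \<in> gen m X \<Longrightarrow> m x y \<in> gen m X"

lemma gen_minimal:
  assumes "X \<subseteq> H" "\<And>x y. x \<in> H \<Longrightarrow> y \<in> H \<Longrightarrow> m x y \<in> H"
  shows "gen m X \<subseteq> H"
proof
  fix z assume "z \<in> gen m X"
  then show "z \<in> H" by induction (use assms in auto)
qed

lemma gen_mono: "X \<subseteq> gen m Y \<Longrightarrow> gen m X \<subseteq> gen m Y"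
  by (rule gen_minimal) (auto intro: gen_mult)

text \<open>Associativity on the whole type makes \<open>assoc\<close> a rewrite rule without
  carrier conditions; \<open>total_op\<close> later supplies such an operation for a semigroup with
  a carrier.\<close>

locale assoc_op =
  fixes m :: "'a \<Rightarrow> 'a \<Rightarrow> 'a"  (infixl "\<star>" 70)
  assumes assoc: "x \<star> y \<star> z = x \<star> (y \<star> z)"
begin

lemma gen_left_induct [consumes 1, case_names base step]:
  assumes w: "w \<in> gen m X"
    and base: "\<And>x. x \<in> X \<Longrightarrow> P x"
    and step: "\<And>x w. x \<in> X \<Longrightarrow> w \<in> gen m X \<Longrightarrow> P w \<Longrightarrow> P (x \<star> w)"
  shows "P w"
proof -
  \<comment> \<open>The second conjunct is inherited by products of any bracketing;
    \<open>P w\<close> alone is not.\<close>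
  from w have "P w \<and> (\<forall>v \<in> gen m X. P v \<longrightarrow> P (w \<star> v))"
  proof induction
    case (gen_base x)
    then show ?case using base step by blast
  next
    case (gen_mult x y)
    then have "P (x \<star> y)" by blast
    moreover have "P (x \<star> y \<star> v)" if "v \<in> gen m X" "P v" for v
    proof -
      have "P (y \<star> v)" "y \<star> v \<in> gen m X" using gen_mult that by (auto intro: gen.gen_mult)
      then show ?thesis using gen_mult by (simp add: assoc)
    qed
    ultimately show ?case by blast
  qed
  then show ?thesis ..
qed

lemma gen_right_induct [consumes 1, case_names base step]:
  assumes w: "w \<in> gen m X"
    and base: "\<And>x. x \<in> X \<Longrightarrow> P x"
    and step: "\<And>x w. x \<in> X \<Longrightarrow> w \<in> gen m X \<Longrightarrow> P w \<Longrightarrow> P (w \<star> x)"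
  shows "P w"
proof -
  from w have "P w \<and> (\<forall>v \<in> gen m X. P v \<longrightarrow> P (v \<star> w))"
  proof induction
    case (gen_base x)
    then show ?case using base step by blast
  next
    case (gen_mult x y)
    then have "P (x \<star> y)" by blast
    moreover have "P (v \<star> (x \<star> y))" if "v \<in> gen m X" "P v" for v
    proof -
      have "P (v \<star> x)" "v \<star> x \<in> gen m X" using gen_mult that by (auto intro: gen.gen_mult)
      then show ?thesis using gen_mult by (simp flip: assoc)
    qed
    ultimately show ?case by blast
  qed
  then show ?thesis ..
qed

lemma gen_left_cases:
  assumes "w \<in> gen m X"
  obtains "w \<in> X" | x v where "x \<in> X" "v \<in> gen m X" "w = x \<star> v"
proof -
  from assms have "w \<in> X \<or> (\<exists>x\<in>X. \<exists>v\<in>gen m X. w = x \<star> v)"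
    by (induction rule: gen_left_induct) (auto intro: gen_base)
  then show thesis using that by blast
qed

text \<open>The exponent is shifted, \<open>pw x n\<close> being the \<open>(n + 1)\<close>-st power, since there is no identity.\<close>

fun pw :: "'a \<Rightarrow> nat \<Rightarrow> 'a" where
  "pw x 0 = x"
| "pw x (Suc n) = pw x n \<star> x"

lemma pw_add: "pw x i \<star> pw x j = pw x (Suc (i + j))"
  by (induction j) (auto simp flip: assoc)

lemma pw_Suc_left: "pw x (Suc n) = x \<star> pw x n"
  using pw_add[of x 0 n] by simp

lemma pw_pw: "pw (pw x i) j = pw x (i + j + i * j)"
  by (induction j) (auto simp: pw_add algebra_simps)

lemma pw_in_gen: "x \<in> gen m X \<Longrightarrow> pw x n \<in> gen m X"
  by (induction n) (auto intro: gen_mult)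

lemma gen_single: "gen m {x} = range (pw x)"
proof
  show "gen m {x} \<subseteq> range (pw x)"
  proof (rule gen_minimal)
    show "{x} \<subseteq> range (pw x)" by (auto intro: range_eqI[of _ _ 0])
    fix y z assume "y \<in> range (pw x)" "z \<in> range (pw x)"
    then show "y \<star> z \<in> range (pw x)" unfolding image_iff by (metis UNIV_I pw_add)
  qed
  show "range (pw x) \<subseteq> gen m {x}" by (auto intro: pw_in_gen gen_base)
qed

lemma gen_single_idem: "x \<star> x = x \<Longrightarrow> gen m {x} = {x}"
proof -
  assume "x \<star> x = x"
  then have "pw x n = x" for n by (induction n) auto
  then show ?thesis by (auto simp: gen_single)
qed

text \<open>After a repetition the powers cycle: beyond index \<open>j\<close> they continue as
  beyond index \<open>i\<close>.\<close>

lemma pw_repeat_finite: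
  assumes "pw x i = pw x j" "i < j"
  shows "finite (gen m {x})"
proof -
  have "pw x n \<in> pw x ` {..j}" for n
  proof (induction n)
    case (Suc n)
    then obtain k where k: "k \<le> j" "pw x n = pw x k" by auto
    then have eq: "pw x (Suc n) = pw x (Suc k)" by simp
    show ?case
    proof (cases "k = j")
      case True
      then have "pw x (Suc n) = pw x (Suc i)" using k assms by simp
      then show ?thesis using assms(2) by (metis Suc_leI atMost_iff image_eqI)
    next
      case False
      then have "Suc k \<le> j" using k by simp
      then show ?thesis using eq by (metis atMost_iff image_eqI)
    qed
  qed (auto intro: image_eqI[of _ _ 0])
  then have "gen m {x} \<subseteq> pw x ` {..j}" by (auto simp: gen_single)
  then show ?thesis by (rule finite_subset) simp
qed

lemma pw_inj_infinite: "infinite (gen m {x}) \<Longrightarrow> pw x i = pw x j \<longleftrightarrow> i = j"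
  using pw_repeat_finite[of x i j] pw_repeat_finite[of x j i] by (metis linorder_neqE_nat)

text \<open>A relation and not a function, since one element is the value of many words; uniqueness
  (\<open>dg_unique\<close>) comes from the infinite order of \<open>a\<close>.\<close>

inductive dg :: "'a \<Rightarrow> 'a \<Rightarrow> 'a \<Rightarrow> int \<Rightarrow> bool" for a b where
  dg_a: "dg a b a 1"
| dg_b: "dg a b b (-1)"
| dg_xa: "dg a b x n \<Longrightarrow> dg a b (x \<star> a) (n + 1)"
| dg_xb: "dg a b x n \<Longrightarrow> dg a b (x \<star> b) (n - 1)"

lemma dg_swap: "dg a b x n \<Longrightarrow> dg b a x (- n)"
proof (induction rule: dg.induct)
  case (dg_xa x n) then show ?case using dg.dg_xb[of b a x "-n"] by simp
next
  case (dg_xb x n) then show ?case using dg.dg_xa[of b a x "-n"] by simp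
qed (use dg.intros[of b a] in auto)

lemma dg_mult: 
  assumes "dg a b y n" "dg a b x k" shows "dg a b (x \<star> y) (k + n)"
  using assms
proof (induction rule: dg.induct)
  case (dg_xa y n)
  then show ?case using dg.dg_xa[of a b "x \<star> y" "k + n"] by (simp add: assoc add.assoc)
next
  case (dg_xb y n)
  then show ?case using dg.dg_xb[of a b "x \<star> y" "k + n"] by (simp add: assoc add_diff_eq)
qed (use dg.intros in force)+

lemma dg_exists: "x \<in> gen m {a, b} \<Longrightarrow> \<exists>n. dg a b x n"
  by (induction rule: gen.induct) (auto intro: dg_a dg_b dg_mult)

lemma dg_pw: "dg a b x n \<Longrightarrow> dg a b (pw x k) (int (Suc k) * n)"
proof (induction k)
  case (Suc k)
  have "dg a b (pw x k \<star> x) (int (Suc k) * n + n)" using Suc by (auto intro: dg_mult)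
  then show ?case by (simp add: algebra_simps)
qed simp

text \<open>A word is tracked through its left translation, so that the empty word is the identity map.
  \<open>Pre D a k f\<close>: \<open>f\<close> is a product \<open>u\<^sub>0 a u\<^sub>1 a \<dots> a u\<^sub>k\<close> with all \<open>u\<^sub>i\<close> in \<open>D\<close>.\<close>

inductive Pre :: "('a \<Rightarrow> 'a) set \<Rightarrow> 'a \<Rightarrow> nat \<Rightarrow> ('a \<Rightarrow> 'a) \<Rightarrow> bool" for D a where
  Pre_0: "u \<in> D \<Longrightarrow> Pre D a 0 u"
| Pre_Suc: "Pre D a k g \<Longrightarrow> u \<in> D \<Longrightarrow> Pre D a (Suc k) (g \<circ> m a \<circ> u)"

lemma Pre_0_iff: "Pre D a 0 f \<longleftrightarrow> f \<in> D"
  by (auto elim: Pre.cases intro: Pre_0)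

lemma Pre_snoc_a: "id \<in> D \<Longrightarrow> Pre D a k f \<Longrightarrow> Pre D a (Suc k) (f \<circ> m a)"
  using Pre_Suc[of D a k f id] by simp

text \<open>The new letter \<open>b\<close> closes against the last letter \<open>a\<close>: the two
  final blocks merge into one element of \<open>D\<close>.\<close>

lemma Pre_snoc_b:
  assumes D: "\<And>u v. u \<in> D \<Longrightarrow> v \<in> D \<Longrightarrow> u \<circ> m a \<circ> v \<circ> m b \<in> D"
    and f: "Pre D a (Suc k) f"
  shows "Pre D a k (f \<circ> m b)"
proof -
  obtain g v where g: "Pre D a k g" "v \<in> D" "f = g \<circ> m a \<circ> v" using f by (cases) auto
  show ?thesis
  proof (cases k)
    case 0
    then show ?thesis using g D by (auto simp: Pre_0_iff)
  next
    case (Suc k')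
    with g(1) have "Pre D a (Suc k') g" by simp
    then obtain g' u where g': "Pre D a k' g'" "u \<in> D" "g = g' \<circ> m a \<circ> u"
      by (cases) auto
    have "Pre D a (Suc k') (g' \<circ> m a \<circ> (u \<circ> m a \<circ> v \<circ> m b))"
      using g'(1) D[OF g'(2) g(2)] by (rule Pre_Suc)
    then show ?thesis using Suc g g' by (simp add: comp_assoc)
  qed
qed

lemma Pre_close:
  assumes D: "\<And>u v. u \<in> D \<Longrightarrow> v \<in> D \<Longrightarrow> u \<circ> m a \<circ> v \<circ> m b \<in> D"
  shows "Pre D a k f \<Longrightarrow> f \<circ> (m b ^^ k) \<in> D"
proof (induction k arbitrary: f)
  case 0
  then show ?case by (simp add: Pre_0_iff)
next
  case (Suc k)
  from Suc.IH[OF Pre_snoc_b[OF D Suc.prems]] show ?case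
    by (simp add: comp_assoc fun_eq_iff funpow_swap1)
qed

lemma mult_funpow: "(m x ^^ Suc n) y = pw x n \<star> y"
  by (induction n) (auto simp: assoc pw_Suc_left simp del: pw.simps(2))

end

section \<open>Semigroups whose idempotents form a subsemigroup\<close>

text \<open>Kept this weak because the image \<open>T\<close> has to be an instance before it is
  known to be regular.\<close>

locale idem_closed = assoc_op +
  fixes S :: "'a set"
  assumes closed: "x \<in> S \<Longrightarrow> y \<in> S \<Longrightarrow> x \<star> y \<in> S"
    and idem_mult: "\<lbrakk>e \<in> S; f \<in> S; e \<star> e = e; f \<star> f = f\<rbrakk> \<Longrightarrow> (e \<star> f) \<star> (e \<star> f) = e \<star> f"
begin

definition E :: "'a set" where "E = {e \<in> S. e \<star> e = e}"

lemma E_iff: "e \<in> E \<longleftrightarrow> e \<in> S \<and> e \<star> e = e"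
  by (simp add: E_def)

lemma E_mult: "e \<in> E \<Longrightarrow> f \<in> E \<Longrightarrow> e \<star> f \<in> E"
  using idem_mult closed by (simp add: E_iff)

lemma E_S: "e \<in> E \<Longrightarrow> e \<in> S"
  by (simp add: E_iff)

lemma E_idem: "e \<in> E \<Longrightarrow> e \<star> e = e"
  by (simp add: E_iff)

lemma E_idem_left: "e \<in> E \<Longrightarrow> e \<star> (e \<star> x) = e \<star> x"
  by (metis E_idem assoc)

lemma gen_S: "X \<subseteq> S \<Longrightarrow> gen m X \<subseteq> S"
  by (rule gen_minimal) (auto intro: closed)

lemma pw_S: "x \<in> S \<Longrightarrow> pw x n \<in> S"
  by (induction n) (auto intro: closed)

text \<open>In a band, \<open>x = pyq\<close> says that the rectangular component of \<open>x\<close> lies below that of \<open>y\<close>.\<close>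

lemma band_sandwich:
  assumes "p \<in> E" "y \<in> E" "q \<in> E"
  shows "p \<star> y \<star> q \<star> y \<star> (p \<star> y \<star> q) = p \<star> y \<star> q"
proof -
  define u where "u = y \<star> q"
  define v where "v = y \<star> p"
  have "u \<in> E" "v \<in> E" using assms by (simp_all add: u_def v_def E_mult)
  then have vu: "v \<star> u \<star> (v \<star> u) = v \<star> u" by (intro E_idem E_mult)
  have "(p \<star> y) \<star> (p \<star> y) = p \<star> y" using assms by (intro E_idem E_mult)
  then have pvu: "p \<star> (v \<star> u) = p \<star> u" unfolding u_def v_def by (metis assoc)
  have "p \<star> u \<star> (v \<star> u) = p \<star> u" using vu pvu by (metis assoc)
  then show ?thesis by (simp add: u_def v_def assoc)
qed

text \<open>\<open>x' \<star> x\<close> and \<open>y \<star> y'\<close> are idempotent, hence so is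
  their product, which occurs squared in the middle of the left-hand side.\<close>

lemma regular_mult:
  assumes "x \<in> S" "y \<in> S" "x' \<in> S" "y' \<in> S" "x \<star> x' \<star> x = x" "y \<star> y' \<star> y = y"
  shows "(x \<star> y) \<star> (y' \<star> x') \<star> (x \<star> y) = x \<star> y"
proof -
  have "x' \<star> x \<in> E" "y \<star> y' \<in> E" using assms by (simp_all add: E_iff closed) (metis assoc)+
  then have g: "(x' \<star> x \<star> (y \<star> y')) \<star> (x' \<star> x \<star> (y \<star> y')) = x' \<star> x \<star> (y \<star> y')"
    using E_idem E_mult by blast
  have "(x \<star> y) \<star> (y' \<star> x') \<star> (x \<star> y) = (x \<star> x' \<star> x) \<star> y \<star> (y' \<star> x') \<star> (x \<star> (y \<star> y' \<star> y))"
    using assms by simp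
  also have "\<dots> = x \<star> ((x' \<star> x \<star> (y \<star> y')) \<star> (x' \<star> x \<star> (y \<star> y'))) \<star> y"
    by (simp add: assoc)
  also have "\<dots> = (x \<star> x' \<star> x) \<star> (y \<star> y' \<star> y)" unfolding g by (simp add: assoc)
  finally show ?thesis using assms by simp
qed

lemma regular_gen:
  assumes "X \<subseteq> S" "\<And>x. x \<in> X \<Longrightarrow> \<exists>x'\<in>S. x \<star> x' \<star> x = x" "z \<in> gen m X"
  shows "\<exists>z'\<in>S. z \<star> z' \<star> z = z"
  using assms(3)
proof induction
  case (gen_mult x y)
  then obtain x' y' where *: "x' \<in> S" "y' \<in> S" "x \<star> x' \<star> x = x" "y \<star> y' \<star> y = y" by blast
  have "x \<in> S" "y \<in> S" using gen_mult gen_S[OF assms(1)] by auto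
  then show ?case using regular_mult * closed by meson
qed (use assms in auto)

end

locale inverse_pair = idem_closed +
  fixes a b :: 'a
  assumes a_S [simp]: "a \<in> S" and b_S [simp]: "b \<in> S"
    and aba: "a \<star> b \<star> a = a" and bab: "b \<star> a \<star> b = b"
begin

lemma swap: "inverse_pair m S b a"
  by unfold_locales (simp_all add: aba bab)

lemma ab_E [simp]: "a \<star> b \<in> E" and ba_E [simp]: "b \<star> a \<in> E"
  using aba bab by (auto simp: E_iff closed assoc)

lemma aba': "a \<star> (b \<star> a) = a" and bab': "b \<star> (a \<star> b) = b"
  using aba bab by (simp_all add: assoc)

lemma aba_left: "a \<star> (b \<star> (a \<star> x)) = a \<star> x" and bab_left: "b \<star> (a \<star> (b \<star> x)) = b \<star> x"
  by (metis aba assoc, metis bab assoc)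

lemma dg_S: "dg a b x n \<Longrightarrow> x \<in> S"
  by (induction rule: dg.induct) (auto intro: closed)

text \<open>This plays the role of \<open>x \<le> a\<^sup>n\<close> in the natural partial order of an inverse semigroup.\<close>

definition upper :: "'a \<Rightarrow> nat \<Rightarrow> bool" where
  "upper x n \<longleftrightarrow> (case n of 0 \<Rightarrow> x \<star> x = x | Suc k \<Rightarrow> x \<star> pw b k \<star> x = x)"

lemma upper_simps [simp]:
  "upper x 0 \<longleftrightarrow> x \<star> x = x" "upper x (Suc k) \<longleftrightarrow> x \<star> pw b k \<star> x = x"
  by (simp_all add: upper_def)

text \<open>For \<open>n = Suc k\<close>, the element \<open>p = pw b k \<star> x\<close> is
  idempotent with \<open>x \<star> p = x\<close>. Both sides of the claim are
  \<open>x \<star> (p \<star> (a \<star> b)) \<star> a\<close>, with the idempotent in the middle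
  written once or twice.\<close>

lemma upper_xa:
  assumes "x \<in> S" "upper x n" shows "upper (x \<star> a) (Suc n)"
proof (cases n)
  case 0
  then have "x \<in> E" using assms by (simp add: E_iff)
  then have "x \<star> (a \<star> b) \<in> E" using E_mult ab_E by blast
  then have "(x \<star> (a \<star> b)) \<star> (x \<star> (a \<star> b)) \<star> a = x \<star> (a \<star> b) \<star> a" by (simp add: E_idem)
  then show ?thesis using 0 by (simp add: assoc aba')
next
  case (Suc k)
  define p where "p = pw b k \<star> x"
  have xp: "x \<star> p = x" using assms Suc by (simp add: p_def assoc)
  then have "p \<in> E" using assms pw_S by (auto simp: E_iff closed p_def assoc)
  then have "p \<star> (a \<star> b) \<in> E" using E_mult ab_E by blast
  then have "x \<star> ((p \<star> (a \<star> b)) \<star> (p \<star> (a \<star> b))) \<star> a = x \<star> (p \<star> (a \<star> b)) \<star> a"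
    by (simp add: E_idem)
  then have "x \<star> (a \<star> b) \<star> p \<star> a = x \<star> a"
    using xp by (metis aba assoc)
  then show ?thesis using Suc by (simp add: p_def assoc pw_Suc_left del: pw.simps(2))
qed

lemma upper_xb:
  assumes "upper x (Suc n)" shows "upper (x \<star> b) n"
proof (cases n)
  case 0
  then show ?thesis using assms by (simp add: assoc) (metis assoc)
next
  case (Suc k)
  then show ?thesis using assms by (simp add: assoc pw_Suc_left del: pw.simps(2)) (metis assoc)
qed

text \<open>Both signs go through one induction, because the degrees of the prefixes of a word may
  change sign; at degree \<open>0\<close> both halves say that \<open>x\<close> is
  idempotent.\<close>

lemma dg_upper_pos:
  assumes "dg a b x n"
  shows "(n \<ge> 0 \<longrightarrow> upper x (nat n)) \<and> (n \<le> 0 \<longrightarrow> inverse_pair.upper m a x (nat (- n)))"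
proof -
  interpret sw: inverse_pair m S b a by (rule swap)
  show ?thesis using assms
  proof (induction rule: dg.induct)
    case dg_a
    then show ?case using aba by simp
  next
    case dg_b
    then show ?case using bab by simp
  next
    case (dg_xa x n)
    have S: "x \<in> S" using dg_xa.hyps by (rule dg_S)
    have "upper (x \<star> a) (nat (n + 1))" if "n + 1 \<ge> 0"
    proof (cases "n \<ge> 0")
      case True
      then show ?thesis using dg_xa.IH upper_xa[OF S, of "nat n"] by (simp add: nat_add_distrib)
    next
      case False
      then have n: "n = -1" using that by simp
      then have "sw.upper x (Suc 0)" using dg_xa.IH by simp
      from sw.upper_xb[OF this] show ?thesis using n by simp
    qed
    moreover have "sw.upper (x \<star> a) (nat (- (n + 1)))" if "n + 1 \<le> 0"
    proof -
      have "sw.upper x (Suc (nat (- (n + 1))))" using dg_xa.IH that by (simp add: Suc_nat_eq_nat_zadd1)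
      then show ?thesis by (rule sw.upper_xb)
    qed
    ultimately show ?case by blast
  next
    case (dg_xb x n)
    have S: "x \<in> S" using dg_xb.hyps by (rule dg_S)
    have "sw.upper (x \<star> b) (nat (- (n - 1)))" if "n - 1 \<le> 0"
    proof (cases "n \<le> 0")
      case True
      then have "sw.upper (x \<star> b) (Suc (nat (- n)))" using dg_xb.IH sw.upper_xa[OF S] by blast
      moreover have "Suc (nat (- n)) = nat (- (n - 1))" using True by simp
      ultimately show ?thesis by metis
    next
      case False
      then have n: "n = 1" using that by simp
      then have "upper x (Suc 0)" using dg_xb.IH by simp
      from upper_xb[OF this] show ?thesis using n by simp
    qed
    moreover have "upper (x \<star> b) (nat (n - 1))" if "n - 1 \<ge> 0"
    proof -
      have "nat n = Suc (nat (n - 1))" using that by simp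
      then have "upper x (Suc (nat (n - 1)))" using dg_xb.IH that by simp
      then show ?thesis by (rule upper_xb)
    qed
    ultimately show ?case by blast
  qed
qed

lemma dg_0_E: "dg a b x 0 \<Longrightarrow> x \<in> E"
  using dg_upper_pos[of x 0] dg_S by (simp add: E_iff)

lemma dg_pos_upper: "dg a b x (int (Suc k)) \<Longrightarrow> x \<star> pw b k \<star> x = x"
  using dg_upper_pos[of x "int (Suc k)"] by (simp add: nat_add_distrib)

lemma dg_pw_a: "dg a b (pw a k) (int (Suc k))"
  using dg_pw[OF dg_a, of a b k] by simp

lemma dg_pw_b: "dg a b (pw b k) (- int (Suc k))"
  using dg_pw[OF dg_b, of a b k] by simp

lemma pw_inverse: "pw a k \<star> pw b k \<star> pw a k = pw a k"
  using dg_pos_upper[OF dg_pw_a] .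

lemma pw_b_pw_a_E: "pw b k \<star> pw a k \<in> E" and pw_a_pw_b_E: "pw a k \<star> pw b k \<in> E"
  using dg_mult[OF dg_pw_a dg_pw_b, of k k] dg_mult[OF dg_pw_b dg_pw_a, of k k] by (auto intro: dg_0_E)

text \<open>The factorisation \<open>x = (x b\<^sup>n) a\<^sup>n (b\<^sup>n x)\<close>.\<close>

lemma dg_factor:
  assumes "dg a b x (int (Suc k))"
  obtains g h where "g \<in> E" "h \<in> E" "x = g \<star> pw a k \<star> h"
proof -
  have "dg a b (x \<star> pw b k) 0" "dg a b (pw b k \<star> x) 0"
    using dg_mult[OF assms dg_pw_b] dg_mult[OF dg_pw_b assms] by (metis add.right_inverse, metis add.left_inverse)
  then have "x \<star> pw b k \<in> E" "pw b k \<star> x \<in> E" by (auto intro: dg_0_E)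
  moreover have "x = (x \<star> pw b k) \<star> pw a k \<star> (pw b k \<star> x)"
  proof -
    interpret sw: inverse_pair m S b a by (rule swap)
    have "pw b k \<star> pw a k \<star> pw b k = pw b k" by (rule sw.pw_inverse)
    then show ?thesis using dg_pos_upper[OF assms] by (metis assoc)
  qed
  ultimately show thesis using that by blast
qed

text \<open>By \<open>dg_factor\<close>, the letter \<open>b\<close> survives only inside
  idempotents. In this form \<open>product_not_pos\<close> receives its information on positive
  words.\<close>

lemma dg_pos_gen:
  assumes "dg a b x n" "n > 0" shows "x \<in> gen m (E \<union> {a})"
proof -
  obtain k where "n = int (Suc k)" using assms(2) by (metis gr0_implies_Suc pos_int_cases)
  then obtain g h where *: "g \<in> E" "h \<in> E" "x = g \<star> pw a k \<star> h" using assms dg_factor by metis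
  then show ?thesis by (auto intro!: gen_mult pw_in_gen intro: gen_base)
qed

end

section \<open>The degree of an element\<close>

context inverse_pair
begin

text \<open>Left translations by idempotents that fix all high powers of \<open>a\<close>, together with the identity.
  Since \<open>a\<^sup>n w b\<^bsup>n+d\<^esup>\<close> is of this kind for a word \<open>w\<close> of degree \<open>d\<close> and large \<open>n\<close>, high powers of \<open>a\<close>
  see the degree of a word.\<close>

definition stab :: "('a \<Rightarrow> 'a) set" where
  "stab = {u. (u = id \<or> (\<exists>h\<in>E. u = m h)) \<and> (\<exists>N. \<forall>k\<ge>N. u (pw a k) = pw a k)}"

lemma id_stab: "id \<in> stab"
  by (simp add: stab_def)

lemma stabI: "u = id \<or> (\<exists>h\<in>E. u = m h) \<Longrightarrow> (\<And>k. k \<ge> N \<Longrightarrow> u (pw a k) = pw a k) \<Longrightarrow> u \<in> stab"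
  unfolding stab_def by blast

lemma stab_cases:
  assumes "u \<in> stab"
  obtains "u = id" | h N where "h \<in> E" "u = m h" "\<And>k. k \<ge> N \<Longrightarrow> h \<star> pw a k = pw a k"
  using assms unfolding stab_def by blast

lemma conj_E:
  assumes "h \<in> E" shows "a \<star> h \<star> b \<in> E"
proof -
  have "h \<star> (b \<star> a) \<in> E" using assms by (rule E_mult) simp
  then have "h \<star> (b \<star> a) \<star> (h \<star> (b \<star> a)) = h \<star> (b \<star> a)" by (rule E_idem)
  then have "a \<star> (h \<star> (b \<star> a) \<star> (h \<star> (b \<star> a))) \<star> b = a \<star> (h \<star> (b \<star> a)) \<star> b" by (rule arg_cong)
  then show ?thesis using assms by (simp add: E_iff closed assoc bab')
qed

lemma stab_nest_cases:
  assumes "v \<in> stab"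
  obtains g N where "g \<in> E" "m a \<circ> v \<circ> m b = m g" "\<And>k. k \<ge> N \<Longrightarrow> g \<star> pw a k = pw a k"
  using assms
proof (cases rule: stab_cases)
  case 1
  have "a \<star> b \<star> pw a k = pw a k" for k
    by (cases k) (simp_all add: pw_Suc_left assoc aba' aba_left del: pw.simps(2))
  moreover have "m a \<circ> v \<circ> m b = m (a \<star> b)" using 1 by (simp add: fun_eq_iff assoc)
  ultimately show thesis using that[of "a \<star> b"] by simp
next
  case (2 h N)
  have "a \<star> h \<star> b \<star> pw a k = pw a k" if "k \<ge> Suc N" for k
  proof -
    obtain j where j: "k = Suc j" "j \<ge> N" using \<open>k \<ge> Suc N\<close> by (cases k) auto
    have h: "h \<star> pw a j = pw a j" using 2 j by blast
    \<comment> \<open>Inserting \<open>h\<close> in front of \<open>pw a j\<close>, which it fixes,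
      makes \<open>(b \<star> a) \<star> h\<close> appear twice.\<close>
    have "(b \<star> a) \<star> h \<in> E" by (rule E_mult) (simp_all add: 2)
    then have "(b \<star> a) \<star> h \<star> ((b \<star> a) \<star> h) = (b \<star> a) \<star> h" by (rule E_idem)
    then have "a \<star> ((b \<star> a) \<star> h \<star> ((b \<star> a) \<star> h)) \<star> pw a j = a \<star> ((b \<star> a) \<star> h) \<star> pw a j"
      by (rule arg_cong)
    then show ?thesis using h by (simp add: j pw_Suc_left assoc aba_left del: pw.simps(2))
  qed
  moreover have "m a \<circ> v \<circ> m b = m (a \<star> h \<star> b)" using 2(2) by (simp add: fun_eq_iff assoc)
  ultimately show thesis using that[of "a \<star> h \<star> b"] conj_E[OF 2(1)] by blast
qed

lemma stab_nest:
  assumes u: "u \<in> stab" and v: "v \<in> stab"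
  shows "u \<circ> m a \<circ> v \<circ> m b \<in> stab"
proof -
  obtain g N where g: "g \<in> E" "m a \<circ> v \<circ> m b = m g" "\<And>k. k \<ge> N \<Longrightarrow> g \<star> pw a k = pw a k"
    using stab_nest_cases[OF v] by blast
  have eq: "u \<circ> m a \<circ> v \<circ> m b = u \<circ> m g" unfolding g(2)[symmetric] by (simp add: comp_assoc)
  from u show ?thesis
  proof (cases rule: stab_cases)
    case 1
    show ?thesis unfolding eq
      by (rule stabI[of _ N]) (use g 1 in auto)
  next
    case (2 h M)
    have "u \<circ> m g = m (h \<star> g)" using 2(2) by (simp add: fun_eq_iff assoc)
    moreover have "h \<star> g \<in> E" using 2(1) g(1) by (rule E_mult)
    moreover have "h \<star> g \<star> pw a k = pw a k" if "k \<ge> M + N" for k using that 2(3) g(3) by (simp add: assoc)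
    ultimately show ?thesis unfolding eq by (intro stabI[of _ "M + N"]) auto
  qed
qed

text \<open>The letters \<open>a\<close> put in front keep the number of unclosed letters
  \<open>a\<close> from becoming negative along the word; hence the restriction to large
  \<open>k\<close>.\<close>

lemma dg_Pre:
  assumes "dg a b x n"
  shows "\<exists>N. \<forall>k. int k + n \<ge> 0 \<and> k \<ge> N \<longrightarrow> Pre stab a (nat (int k + n)) ((m a ^^ k) \<circ> m x)"
  using assms
proof (induction rule: dg.induct)
  case dg_a
  have "Pre stab a (Suc k) ((m a ^^ k) \<circ> m a)" for k
  proof (induction k)
    case 0
    then show ?case using Pre_snoc_a[OF id_stab Pre_0[OF id_stab]] by simp
  next
    case (Suc k)
    then show ?case using Pre_snoc_a[OF id_stab Suc] by (simp only: funpow_Suc_right)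
  qed
  moreover have "nat (int k + 1) = Suc k" for k by simp
  ultimately show ?case by metis
next
  case dg_b
  have P: "Pre stab a k (m a ^^ k)" for k
  proof (induction k)
    case 0
    then show ?case using Pre_0[OF id_stab] by (simp only: funpow.simps)
  next
    case (Suc k)
    then show ?case using Pre_snoc_a[OF id_stab Suc] by (simp only: funpow_Suc_right)
  qed
  have "Pre stab a (nat (int k + - 1)) ((m a ^^ k) \<circ> m b)" if "int k + -1 \<ge> 0" for k
  proof -
    from that have "k > 0" by simp
    then obtain j where "k = Suc j" using gr0_implies_Suc by blast
    then show ?thesis using Pre_snoc_b[OF stab_nest P[of "Suc j"]] by simp
  qed
  then show ?case by blast
next
  case (dg_xa x n)
  then obtain N where N: "Pre stab a (nat (int k + n)) ((m a ^^ k) \<circ> m x)"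
    if "int k + n \<ge> 0" "k \<ge> N" for k by blast
  have "Pre stab a (nat (int k + (n + 1))) ((m a ^^ k) \<circ> m (x \<star> a))" if "k \<ge> N + nat (- n)" for k
  proof -
    have "int k + n \<ge> 0" using that by linarith
    then have "Pre stab a (Suc (nat (int k + n))) ((m a ^^ k) \<circ> m x \<circ> m a)"
      using that by (intro Pre_snoc_a id_stab N) auto
    moreover have "Suc (nat (int k + n)) = nat (int k + (n + 1))" using \<open>int k + n \<ge> 0\<close> by simp
    moreover have "(m a ^^ k) \<circ> m x \<circ> m a = (m a ^^ k) \<circ> m (x \<star> a)" by (simp add: fun_eq_iff assoc)
    ultimately show ?thesis by metis
  qed
  then show ?case by blast
next
  case (dg_xb x n)
  then obtain N where N: "Pre stab a (nat (int k + n)) ((m a ^^ k) \<circ> m x)"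
    if "int k + n \<ge> 0" "k \<ge> N" for k by blast
  have "Pre stab a (nat (int k + (n - 1))) ((m a ^^ k) \<circ> m (x \<star> b))"
    if "int k + (n - 1) \<ge> 0" "k \<ge> N" for k
  proof -
    have "Suc (nat (int k + (n - 1))) = nat (int k + n)" using that by simp
    then have "Pre stab a (Suc (nat (int k + (n - 1)))) ((m a ^^ k) \<circ> m x)"
      using N[of k] that by simp
    from Pre_snoc_b[OF stab_nest this] show ?thesis by (simp add: comp_def assoc)
  qed
  then show ?case by blast
qed

text \<open>If \<open>x = x \<star> x\<close>, then \<open>x\<close> also has degree
  \<open>2n\<close>. Closing the word \<open>a\<close>-power times \<open>x\<close> by as many
  letters \<open>b\<close> as either degree dictates gives two elements of \<open>stab\<close> that
  differ by \<open>n\<close> letters \<open>b\<close>. From them arises an idempotent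
  \<open>G\<close> that raises the exponent of every high power of \<open>a\<close> by
  \<open>n\<close>; applying \<open>G\<close> twice must have the same effect as once, against the
  distinctness of the powers.\<close>

lemma pos_degree_not_idem:
  assumes a: "infinite (gen m {a})" and x: "dg a b x n" "n > 0" shows "x \<star> x \<noteq> x"
proof
  assume xx: "x \<star> x = x"
  obtain d where d: "n = int (Suc d)" using x(2) by (metis gr0_implies_Suc pos_int_cases)
  have x2: "dg a b x (n + n)" using dg_mult[OF x(1) x(1)] xx by simp
  obtain M where M: "Pre stab a (nat (int k + n)) ((m a ^^ k) \<circ> m x)" if "int k + n \<ge> 0" "k \<ge> M" for k
    using dg_Pre[OF x(1)] by blast
  obtain N where N: "Pre stab a (nat (int k + (n + n))) ((m a ^^ k) \<circ> m x)"
    if "int k + (n + n) \<ge> 0" "k \<ge> N" for k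
    using dg_Pre[OF x2] by blast
  define k where "k = M + N"
  define u where "u = (m a ^^ k) \<circ> m x \<circ> (m b ^^ (k + Suc d))"
  have "Pre stab a (k + Suc d) ((m a ^^ k) \<circ> m x)" using M[of k] d by (simp add: k_def nat_add_distrib)
  then have u: "u \<in> stab" using Pre_close[OF stab_nest] unfolding u_def by blast
  have e: "nat (int k + (n + n)) = k + Suc d + Suc d" using d by linarith
  have "Pre stab a (k + Suc d + Suc d) ((m a ^^ k) \<circ> m x)"
    using N[of k] d unfolding e[symmetric] by (simp add: k_def)
  from Pre_close[OF stab_nest this] have u': "u \<circ> (m b ^^ Suc d) \<in> stab"
    unfolding u_def by (simp only: funpow_add comp_assoc)
  define F where "F = pw b d \<star> pw a d"
  have F: "F \<in> E" unfolding F_def by (rule pw_b_pw_a_E)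
  obtain K where K: "(u \<circ> (m b ^^ Suc d)) (pw a j) = pw a j" if "j \<ge> K" for j
    using u' by (auto simp: stab_def)
  have uF: "u (F \<star> pw a j) = pw a (Suc (d + j))" if "j \<ge> K" for j
  proof -
    have "F \<star> pw a j = (m b ^^ Suc d) (pw a (Suc (d + j)))"
      unfolding mult_funpow F_def by (simp only: assoc pw_add)
    then show ?thesis using K[of "Suc (d + j)"] that by simp
  qed
  obtain G where G: "G \<in> E" "\<And>y. u (F \<star> y) = G \<star> y"
  proof -
    from u consider "u = id" | h where "h \<in> E" "u = m h" by (auto simp: stab_def)
    then show thesis
    proof cases
      case 1
      then show thesis using F that by simp
    next
      case 2
      then show thesis using F E_mult that[of "h \<star> F"] by (simp add: assoc)
    qed
  qed
  have GK: "G \<star> pw a j = pw a (Suc (d + j))" if "j \<ge> K" for j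
    using uF[OF that] by (simp only: G(2))
  have "pw a (Suc (d + K)) = G \<star> (G \<star> pw a K)" using GK[of K] E_idem_left[OF G(1), of "pw a K"] by (metis order_refl)
  also have "\<dots> = pw a (Suc (d + Suc (d + K)))" using GK[of K] GK[of "Suc (d + K)"] by simp
  finally show False unfolding pw_inj_infinite[OF a] by simp
qed

text \<open>If \<open>pw b i = pw b j\<close>, then \<open>pw b i\<close> can replace the inner
  factor of \<open>pw_inverse\<close> for \<open>j\<close>; cancelling it leaves
  \<open>pw a j\<close> equal to a higher power of \<open>a\<close>.\<close>

lemma infinite_b:
  assumes a: "infinite (gen m {a})" shows "infinite (gen m {b})"
proof
  assume "finite (gen m {b})"
  then have "\<not> inj (pw b)" by (metis gen_single finite_imageD infinite_UNIV_nat)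
  then obtain i j where ij: "i < j" "pw b i = pw b j" by (metis injI linorder_neqE_nat)
  obtain l where l: "j = Suc (i + l)" using ij(1) by (metis less_iff_Suc_add)
  have 1: "pw a j = pw a l \<star> pw a i" using l pw_add[of a l i] by (simp add: add.commute)
  have 2: "pw a j = pw a i \<star> pw a l" using l pw_add[of a i l] by simp
  have "pw a j = pw a j \<star> pw b i \<star> pw a j" unfolding ij(2) by (rule pw_inverse[symmetric])
  also have "\<dots> = pw a l \<star> (pw a i \<star> pw b i \<star> pw a i) \<star> pw a l"
    using 1 2 by (metis assoc)
  also have "\<dots> = pw a l \<star> pw a j" unfolding pw_inverse 2 by (rule assoc)
  also have "\<dots> = pw a (Suc (l + j))" by (rule pw_add)
  finally show False unfolding pw_inj_infinite[OF a] by simp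
qed

end

locale monogenic = inverse_pair +
  assumes gen_ab: "gen m {a, b} = S" and infinite_a: "infinite (gen m {a})"
begin

lemma dg_idem_iff:
  assumes "dg a b x n" shows "x \<star> x = x \<longleftrightarrow> n = 0"
proof -
  interpret sw: inverse_pair m S b a by (rule swap)
  have "x \<star> x \<noteq> x" if "n > 0" using pos_degree_not_idem[OF infinite_a assms that] .
  moreover have "x \<star> x \<noteq> x" if "n < 0"
    using sw.pos_degree_not_idem[OF infinite_b[OF infinite_a] dg_swap[OF assms]] that by simp
  moreover have "x \<star> x = x" if "n = 0" using assms that dg_0_E E_idem by blast
  ultimately show ?thesis by (metis linorder_neqE_linordered_idom)
qed

lemma dg_power_exists: "\<exists>y. dg a b y n \<or> n = 0"
proof -
  consider "n = 0" | k where "n = int (Suc k)" | k where "n = - int (Suc k)"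
    by (metis gr0_implies_Suc int_cases3)
  then show ?thesis using dg_pw_a dg_pw_b by cases blast+
qed

text \<open>Multiplying by an element of degree \<open>-k\<close> makes the product idempotent
  according to one degree, which forces the other one to be \<open>0\<close> as well.\<close>

lemma dg_unique:
  assumes "dg a b x k" "dg a b x n" shows "k = n"
proof (cases "k = 0 \<or> n = 0")
  case True
  then show ?thesis using dg_idem_iff assms by metis
next
  case False
  obtain y where y: "dg a b y (- k)" using dg_power_exists[of "-k"] False by auto
  have "dg a b (x \<star> y) (k + - k)" "dg a b (x \<star> y) (n + - k)"
    using dg_mult[OF y assms(1)] dg_mult[OF y assms(2)] by simp_all
  then have "n + - k = 0" using dg_idem_iff[of "x \<star> y" "k + - k"] dg_idem_iff[of "x \<star> y" "n + - k"] by simp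
  then show ?thesis by simp
qed

definition deg :: "'a \<Rightarrow> int" where "deg x = (THE n. dg a b x n)"

lemma dg_deg: "x \<in> S \<Longrightarrow> dg a b x (deg x)"
  unfolding deg_def using dg_exists dg_unique gen_ab by (metis theI)

lemma deg_eq: "dg a b x n \<Longrightarrow> deg x = n"
  using dg_deg dg_unique dg_S by blast

lemma deg_mult: "x \<in> S \<Longrightarrow> y \<in> S \<Longrightarrow> deg (x \<star> y) = deg x + deg y"
  by (intro deg_eq dg_mult dg_deg)

lemma deg_0_iff: "x \<in> S \<Longrightarrow> deg x = 0 \<longleftrightarrow> x \<star> x = x"
  using dg_deg dg_idem_iff by blast

lemma deg_a [simp]: "deg a = 1" and deg_b [simp]: "deg b = -1"
  by (auto intro: deg_eq dg_a dg_b)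

end

section \<open>Bijections preserving generated subsemigroups\<close>

text \<open>The axioms are invariant under negating \<open>deg\<close> (\<open>graded_flip\<close>),
  so results on positive elements have duals for negative ones.\<close>

locale graded = idem_closed +
  fixes deg :: "'a \<Rightarrow> int"
  assumes deg_mult: "x \<in> S \<Longrightarrow> y \<in> S \<Longrightarrow> deg (x \<star> y) = deg x + deg y"
    and deg_0: "x \<in> S \<Longrightarrow> deg x = 0 \<longleftrightarrow> x \<star> x = x"
begin

lemma deg_0_E: "x \<in> S \<Longrightarrow> deg x = 0 \<longleftrightarrow> x \<in> E"
  by (simp add: deg_0 E_iff)

lemma deg_pw: "x \<in> S \<Longrightarrow> deg (pw x n) = int (Suc n) * deg x"
  by (induction n) (simp_all add: deg_mult pw_S algebra_simps)

lemma gen_single_deg: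
  assumes "x \<in> S" "z \<in> gen m {x}"
  obtains k where "z = pw x k" "deg z = int (Suc k) * deg x"
  using assms deg_pw by (auto simp: gen_single)

lemma deg_gen_pos:
  assumes "z \<in> gen m X" "X \<subseteq> S" "\<And>x. x \<in> X \<Longrightarrow> deg x > 0"
  shows "deg z > 0"
  using assms(1)
proof induction
  case (gen_mult x y)
  then have "x \<in> S" "y \<in> S" using gen_S[OF assms(2)] by auto
  then show ?case using gen_mult by (simp add: deg_mult)
qed (use assms in auto)

lemma gen_single_eq:
  assumes "x \<in> S" "deg x \<noteq> 0" "z \<in> gen m {x}" "deg z = deg x" shows "z = x"
proof -
  obtain k where k: "z = pw x k" "deg z = int (Suc k) * deg x" using gen_single_deg[OF assms(1,3)] .
  then have "int (Suc k) = 1" using assms(2,4) by (simp add: algebra_simps)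
  then show ?thesis using k by simp
qed

lemma gen_E_eq:
  assumes h: "h \<in> E" and x: "x \<in> S" "deg x > 0" and z: "z \<in> gen m {h, x}"
  shows "deg z > 0 \<or> z = h"
  using z
proof induction
  case (gen_mult y z)
  have S: "h \<in> S" "deg h = 0" using h deg_0_E E_S by auto
  then have "y \<in> S" "z \<in> S" using gen_mult gen_S[of "{h, x}"] x by auto
  then have "deg (y \<star> z) = deg y + deg z" by (rule deg_mult)
  then show ?case using gen_mult S h E_idem by auto
qed (use x in auto)

lemma pw_inj: "x \<in> S \<Longrightarrow> deg x \<noteq> 0 \<Longrightarrow> inj (pw x)"
proof (rule injI)
  fix i j assume "x \<in> S" "deg x \<noteq> 0" "pw x i = pw x j"
  then have "int (Suc i) * deg x = int (Suc j) * deg x" using deg_pw by metis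
  then show "i = j" using \<open>deg x \<noteq> 0\<close> by simp
qed

lemma infinite_order: "x \<in> S \<Longrightarrow> deg x \<noteq> 0 \<Longrightarrow> infinite (gen m {x})"
  using pw_inj by (metis gen_single finite_imageD infinite_UNIV_nat)

lemma graded_flip: "graded m S (\<lambda>x. - deg x)"
  by unfold_locales (auto simp: deg_mult deg_0)

end

locale sub_iso = A: graded mA A deg + T: assoc_op mT
  for mA :: "'a \<Rightarrow> 'a \<Rightarrow> 'a" (infixl "\<odot>" 70) and A :: "'a set" and deg :: "'a \<Rightarrow> int"
    and mT :: "'b \<Rightarrow> 'b \<Rightarrow> 'b" (infixl "\<star>" 70) +
  fixes T :: "'b set" and \<phi> :: "'a \<Rightarrow> 'b" and a b :: 'a
  assumes bij: "bij_betw \<phi> A T"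
    and gen_image: "X \<subseteq> A \<Longrightarrow> gen mT (\<phi> ` X) = \<phi> ` gen mA X"
    and a_A [simp]: "a \<in> A" and b_A [simp]: "b \<in> A"
    and gen_ab: "gen mA {a, b} = A"
    and deg_a: "deg a > 0" and deg_b: "deg b < 0"
begin

abbreviation \<psi> :: "'b \<Rightarrow> 'a" where "\<psi> \<equiv> inv_into A \<phi>"

definition dl :: "'b \<Rightarrow> int" where "dl t = deg (\<psi> t)"

lemma phi_T [simp]: "x \<in> A \<Longrightarrow> \<phi> x \<in> T"
  using bij by (auto simp: bij_betw_def)

lemma psi_A [simp]: "t \<in> T \<Longrightarrow> \<psi> t \<in> A"
  using bij by (metis bij_betw_def inv_into_into)

lemma phi_psi [simp]: "t \<in> T \<Longrightarrow> \<phi> (\<psi> t) = t"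
  using bij by (metis bij_betw_def f_inv_into_f)

lemma psi_phi [simp]: "x \<in> A \<Longrightarrow> \<psi> (\<phi> x) = x"
  using bij by (metis bij_betw_def inv_into_f_f)

lemma dl_phi [simp]: "x \<in> A \<Longrightarrow> dl (\<phi> x) = deg x"
  by (simp add: dl_def)

lemma gen_ab_T: "gen mT {\<phi> a, \<phi> b} = T"
  using gen_image[of "{a, b}"] gen_ab bij by (simp add: bij_betw_def)

lemma gen_psi:
  assumes "X \<subseteq> T" "t \<in> gen mT X"
  shows "\<psi> t \<in> gen mA (\<psi> ` X)"
proof -
  have X: "\<phi> ` \<psi> ` X = X" using assms(1) by (force simp: image_iff)
  have S: "\<psi> ` X \<subseteq> A" using assms(1) by auto
  then have "t \<in> \<phi> ` gen mA (\<psi> ` X)" using gen_image[OF S] X assms(2) by simp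
  then obtain z where "z \<in> gen mA (\<psi> ` X)" "t = \<phi> z" by blast
  then show ?thesis using A.gen_S[OF S] by auto
qed

lemma gen_phi:
  assumes "X \<subseteq> A" "x \<in> gen mA X" shows "\<phi> x \<in> gen mT (\<phi> ` X)"
  using gen_image assms by blast

lemma T_closed: "s \<in> T \<Longrightarrow> t \<in> T \<Longrightarrow> s \<star> t \<in> T"
  using gen_ab_T gen_mult by metis

lemma gen_T: "X \<subseteq> T \<Longrightarrow> gen mT X \<subseteq> T"
  by (rule gen_minimal) (auto intro: T_closed)

lemma psi_mult: "s \<in> T \<Longrightarrow> t \<in> T \<Longrightarrow> \<psi> (s \<star> t) \<in> gen mA {\<psi> s, \<psi> t}"
  using gen_psi[of "{s, t}" "s \<star> t"] by (auto intro: gen_base gen_mult)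

lemma gen_psi1: "s \<in> T \<Longrightarrow> t \<in> gen mT {s} \<Longrightarrow> \<psi> t \<in> gen mA {\<psi> s}"
  using gen_psi[of "{s}" t] by simp

lemma psi_inj: "s \<in> T \<Longrightarrow> t \<in> T \<Longrightarrow> \<psi> s = \<psi> t \<Longrightarrow> s = t"
  by (metis phi_psi)

lemma infinite_T:
  assumes "t \<in> T" "dl t \<noteq> 0" shows "infinite (gen mT {t})"
proof -
  have "infinite (gen mA {\<psi> t})" using assms A.infinite_order by (simp add: dl_def)
  moreover have "gen mT {t} = \<phi> ` gen mA {\<psi> t}" using gen_image[of "{\<psi> t}"] assms by simp
  moreover have "inj_on \<phi> (gen mA {\<psi> t})"
    using bij A.gen_S[of "{\<psi> t}"] assms by (metis bij_betw_def inj_on_subset psi_A empty_subsetI insert_subset)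
  ultimately show ?thesis by (simp add: finite_image_iff)
qed

lemma dl_0: "t \<in> T \<Longrightarrow> dl t = 0 \<longleftrightarrow> t \<star> t = t"
proof
  assume t: "t \<in> T" "dl t = 0"
  then have "\<psi> t \<odot> \<psi> t = \<psi> t" using A.deg_0 by (simp add: dl_def)
  then have "gen mA {\<psi> t} = {\<psi> t}" by (rule A.gen_single_idem)
  then have "\<psi> (t \<star> t) = \<psi> t" using psi_mult[of t t] t by simp
  then show "t \<star> t = t" using t by (metis T_closed phi_psi)
next
  assume t: "t \<in> T" "t \<star> t = t"
  then have "gen mT {t} = {t}" by (intro T.gen_single_idem)
  then show "dl t = 0" using infinite_T t by (metis finite.intros)
qed

lemma dl_0_mult:
  assumes "s \<in> T" "t \<in> T" "dl s = 0" "dl t = 0" shows "dl (s \<star> t) = 0"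
proof -
  have "\<psi> s \<in> A.E" "\<psi> t \<in> A.E" using assms A.deg_0_E by (auto simp: dl_def)
  then have "gen mA {\<psi> s, \<psi> t} \<subseteq> A.E" by (intro gen_minimal) (auto intro: A.E_mult)
  then have "\<psi> (s \<star> t) \<in> A.E" using psi_mult assms by blast
  then show ?thesis unfolding dl_def using A.deg_0_E A.E_S by blast
qed

sublocale T: idem_closed mT T
proof
  show "s \<star> t \<in> T" if "s \<in> T" "t \<in> T" for s t using that by (rule T_closed)
  show "e \<star> f \<star> (e \<star> f) = e \<star> f" if "e \<in> T" "f \<in> T" "e \<star> e = e" "f \<star> f = f" for e f
    using that dl_0 dl_0_mult T_closed by metis
qed

lemma dl_0_E: "t \<in> T \<Longrightarrow> dl t = 0 \<longleftrightarrow> t \<in> T.E"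
  by (simp add: dl_0 T.E_iff)

lemma dl_E: "e \<in> T.E \<Longrightarrow> dl e = 0"
  using dl_0_E T.E_S by blast

lemma pos_mult:
  assumes "s \<in> T" "t \<in> T" "dl s > 0" "dl t > 0" shows "dl (s \<star> t) > 0"
  unfolding dl_def using assms
  by (intro A.deg_gen_pos[OF psi_mult]) (auto simp: dl_def)

lemma flip: "sub_iso mA A (\<lambda>x. - deg x) mT T \<phi> b a"
proof -
  interpret f: graded mA A "\<lambda>x. - deg x" by (rule A.graded_flip)
  show ?thesis
    by unfold_locales (use bij gen_image gen_ab deg_a deg_b in \<open>auto simp: insert_commute\<close>)
qed

lemma flip_dl: "sub_iso.dl A (\<lambda>x. - deg x) \<phi> t = - dl t"
  unfolding sub_iso.dl_def[OF flip] dl_def ..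

lemma neg_mult: "s \<in> T \<Longrightarrow> t \<in> T \<Longrightarrow> dl s < 0 \<Longrightarrow> dl t < 0 \<Longrightarrow> dl (s \<star> t) < 0"
  using sub_iso.pos_mult[OF flip] unfolding flip_dl by simp

text \<open>The cube of \<open>t \<star> s\<close> equals its square, so \<open>t \<star> s\<close>
  has finite order, which in \<open>T\<close> makes it idempotent.\<close>

lemma rotate:
  assumes s: "s \<in> T" "t \<in> T" and st: "s \<star> t \<in> T.E" shows "t \<star> s \<in> T.E"
proof -
  let ?u = "t \<star> s"
  have "s \<star> t \<star> (s \<star> t) = s \<star> t" using st by (rule T.E_idem)
  then have "t \<star> (s \<star> t \<star> (s \<star> t)) \<star> s = t \<star> (s \<star> t) \<star> s" by (rule arg_cong)
  then have "T.pw ?u 2 = T.pw ?u 1" by (simp add: numeral_2_eq_2 T.assoc)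
  then have "finite (gen mT {?u})" using T.pw_repeat_finite[of ?u 1 2] by simp
  then have "dl ?u = 0" using infinite_T T_closed s by blast
  then show ?thesis using dl_0_E T_closed s by blast
qed

text \<open>Suitable powers of \<open>s\<close> and \<open>t\<close> have an idempotent product in \<open>A\<close>; a cyclic shift makes its image start with \<open>s\<close>.\<close>

lemma opposite_signs:
  assumes s: "s \<in> T" "t \<in> T" and sgn: "dl s > 0 \<and> dl t < 0 \<or> dl s < 0 \<and> dl t > 0"
  shows "\<exists>w \<in> gen mT {s, t}. s \<star> w \<in> T.E"
proof -
  let ?G = "gen mT {s, t}"
  have G: "?G \<subseteq> T" using s by (intro gen_T) auto
  have inG: "s \<in> ?G" "t \<in> ?G" by (auto intro: gen_base)
  define p where "p = nat \<bar>dl s\<bar>"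
  define q where "q = nat \<bar>dl t\<bar>"
  have pq: "int p = \<bar>dl s\<bar>" "int q = \<bar>dl t\<bar>" "p > 0" "q > 0" using sgn by (auto simp: p_def q_def)
  \<comment> \<open>With the shifted exponents these are the \<open>q\<close>-th power of
    \<open>\<psi> s\<close> and the \<open>p\<close>-th power of \<open>\<psi> t\<close>, whose
    degrees cancel.\<close>
  define z where "z = A.pw (\<psi> s) (q - 1) \<odot> A.pw (\<psi> t) (p - 1)"
  have "deg z = int q * dl s + int p * dl t"
    using s pq by (simp add: z_def A.deg_mult A.pw_S A.deg_pw dl_def)
  also have "\<dots> = 0" using sgn pq by (auto simp: algebra_simps)
  finally have "deg z = 0" .
  have z: "z \<in> A" unfolding z_def using s by (intro A.closed A.pw_S) auto
  have "z \<in> gen mA {\<psi> s, \<psi> t}" unfolding z_def by (intro gen_mult A.pw_in_gen gen_base) auto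
  then have g: "\<phi> z \<in> ?G" using gen_phi[of "{\<psi> s, \<psi> t}" z] s by simp
  have gE: "\<phi> z \<in> T.E" using z \<open>deg z = 0\<close> by (simp add: dl_0_E[symmetric])
  \<comment> \<open>Either \<open>s\<close> does not occur in the word \<open>w\<close>, or an
    occurrence is singled out; the last four alternatives are due to the missing empty word.\<close>
  have "w \<in> gen mT {t} \<or> w = s \<or> (\<exists>v\<in>?G. w = s \<star> v) \<or> (\<exists>u\<in>?G. w = u \<star> s) \<or>
      (\<exists>u\<in>?G. \<exists>v\<in>?G. w = u \<star> (s \<star> v))" if "w \<in> ?G" for w
    using that
  proof (induction rule: T.gen_left_induct)
    case (base x)
    then show ?case by (auto intro: gen_base)
  next
    case (step x w)
    show ?case
    proof (cases "x = s")
      case True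
      then show ?thesis using step by blast
    next
      case False
      then have x: "x = t" using step by simp
      from step.IH show ?thesis
      proof (elim disjE bexE)
        fix u v assume "u \<in> ?G" "v \<in> ?G" "w = u \<star> (s \<star> v)"
        moreover have "t \<star> (u \<star> (s \<star> v)) = (t \<star> u) \<star> (s \<star> v)" by (simp add: T.assoc)
        ultimately show ?thesis using x inG by (metis gen_mult)
      next
        fix u assume "u \<in> ?G" "w = u \<star> s"
        moreover have "t \<star> (u \<star> s) = (t \<star> u) \<star> s" by (simp add: T.assoc)
        ultimately show ?thesis using x inG by (metis gen_mult)
      qed (use x inG in \<open>auto intro: gen_mult gen_base\<close>)
    qed
  qed
  from this[OF g] show ?thesis
  proof (elim disjE bexE)
    assume "\<phi> z \<in> gen mT {t}"
    then have "\<psi> (\<phi> z) \<in> gen mA {\<psi> t}" using s by (intro gen_psi1)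
    then obtain k where "deg z = int (Suc k) * deg (\<psi> t)"
      using A.gen_single_deg[of "\<psi> t" z] z s by auto
    then show ?thesis using \<open>deg z = 0\<close> sgn by (auto simp: dl_def)
  next
    assume "\<phi> z = s" then show ?thesis using gE dl_E sgn by auto
  next
    fix v assume "v \<in> ?G" "\<phi> z = s \<star> v" then show ?thesis using gE by auto
  next
    fix u assume "u \<in> ?G" "\<phi> z = u \<star> s" then show ?thesis using gE rotate s G by (metis subsetD)
  next
    fix u v assume uv: "u \<in> ?G" "v \<in> ?G" "\<phi> z = u \<star> (s \<star> v)"
    then have "(s \<star> v) \<star> u \<in> T.E" using gE rotate[of u "s \<star> v"] s G T_closed by (metis subsetD)
    then show ?thesis using uv by (auto simp: T.assoc intro: gen_mult)
  qed
qed

section \<open>Idempotents of \<open>T\<close> that absorb a non-idempotent element\<close>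

lemma kill_pos:
  assumes "e \<in> T.E" "t \<in> T" "dl t > 0"
  shows "dl (e \<star> t) > 0 \<or> e \<star> t = e" "dl (t \<star> e) > 0 \<or> t \<star> e = e"
proof -
  have e: "e \<in> T" using assms T.E_S by simp
  then have h: "\<psi> e \<in> A.E" using dl_E[OF assms(1)] A.deg_0_E[of "\<psi> e"] by (simp add: dl_def)
  have "deg z > 0 \<or> z = \<psi> e" if "z \<in> gen mA {\<psi> e, \<psi> t}" for z
    using A.gen_E_eq[OF h _ _ that] assms by (simp add: dl_def)
  moreover have "\<psi> (e \<star> t) \<in> gen mA {\<psi> e, \<psi> t}" "\<psi> (t \<star> e) \<in> gen mA {\<psi> e, \<psi> t}"
    using psi_mult[of e t] psi_mult[of t e] e assms by (auto simp: insert_commute)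
  ultimately have "deg (\<psi> (e \<star> t)) > 0 \<or> \<psi> (e \<star> t) = \<psi> e" "deg (\<psi> (t \<star> e)) > 0 \<or> \<psi> (t \<star> e) = \<psi> e"
    by blast+
  then show "dl (e \<star> t) > 0 \<or> e \<star> t = e" "dl (t \<star> e) > 0 \<or> t \<star> e = e"
    using psi_inj e T_closed assms unfolding dl_def by metis+
qed

lemma kill_neg:
  assumes "e \<in> T.E" "t \<in> T" "dl t < 0"
  shows "dl (e \<star> t) < 0 \<or> e \<star> t = e" "dl (t \<star> e) < 0 \<or> t \<star> e = e"
  using sub_iso.kill_pos[OF flip, of e t] assms unfolding flip_dl by simp_all

lemma kill_both:
  assumes "e \<in> T.E" "t \<in> T" "dl t \<noteq> 0" "e \<star> t = e" shows "t \<star> e = e"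
proof -
  have "t \<star> e \<in> T.E" using rotate[of e t] assms T.E_S by simp
  then have "dl (t \<star> e) = 0" by (rule dl_E)
  then show ?thesis using kill_pos(2)[of e t] kill_neg(2)[of e t] assms by linarith
qed

text \<open>Otherwise \<open>u = e \<star> n\<close> is negative and \<open>t \<star> u = u\<close>.
  In the word \<open>w\<close> from \<open>opposite_signs\<close> the letters \<open>t\<close>
  vanish in front of \<open>u\<close>, so \<open>w \<star> u\<close> is a power of \<open>u\<close>;
  but it is also idempotent.\<close>

lemma kill_opposite:
  assumes e: "e \<in> T.E" and t: "t \<in> T" "dl t > 0" "e \<star> t = e" and n: "n \<in> T" "dl n < 0"
  shows "e \<star> n = e"
proof (rule ccontr)
  assume "e \<star> n \<noteq> e"
  define u where "u = e \<star> n"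
  have u: "u \<in> T" "dl u < 0" using \<open>e \<star> n \<noteq> e\<close> kill_neg(1)[OF e n] n T.E_S[OF e] T_closed
    by (auto simp: u_def)
  have te: "t \<star> e = e" using kill_both[OF e t(1) _ t(3)] t(2) by simp
  have tu: "t \<star> u = u" unfolding u_def using te by (simp flip: T.assoc)
  obtain w where w: "w \<in> gen mT {u, t}" "u \<star> w \<in> T.E" using opposite_signs[of u t] u t by auto
  have "w \<star> u \<in> gen mT {u}"
    using w(1)
  proof (induction rule: T.gen_left_induct)
    case (base x)
    then show ?case using tu by (auto intro: gen_mult gen_base)
  next
    case (step x w)
    from step.IH obtain k where k: "w \<star> u = T.pw u k" by (auto simp: T.gen_single)
    have tk: "t \<star> T.pw u k = T.pw u k"
    proof (cases k)
      case 0
      then show ?thesis using tu by simp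
    next
      case (Suc j)
      have "t \<star> (u \<star> T.pw u j) = u \<star> T.pw u j" using tu by (simp flip: T.assoc)
      then show ?thesis unfolding Suc T.pw_Suc_left .
    qed
    have uk: "u \<star> T.pw u k = T.pw u (Suc k)" by (simp only: T.pw_Suc_left)
    have "x \<star> w \<star> u = x \<star> T.pw u k" unfolding T.assoc k ..
    moreover have "x = u \<or> x = t" using step.hyps by blast
    ultimately show ?case using tk uk unfolding T.gen_single by (metis rangeI)
  qed
  moreover have "w \<in> T" using w(1) gen_T[of "{u, t}"] u t by auto
  ultimately have "\<psi> (w \<star> u) \<in> gen mA {\<psi> u}" "w \<star> u \<in> T.E"
    using gen_psi1[OF u(1)] rotate[OF u(1) _ w(2)] by blast+
  then have "deg (\<psi> (w \<star> u)) = 0" using dl_E[of "w \<star> u"] by (simp add: dl_def)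
  moreover obtain k where "deg (\<psi> (w \<star> u)) = int (Suc k) * deg (\<psi> u)"
    using A.gen_single_deg[OF psi_A[OF u(1)] \<open>\<psi> (w \<star> u) \<in> gen mA {\<psi> u}\<close>] .
  ultimately show False using u by (simp add: dl_def)
qed

lemma kill_zero:
  assumes e: "e \<in> T.E" and t: "t \<in> T" "dl t > 0" "e \<star> t = e" and s: "s \<in> T"
  shows "e \<star> s = e" "s \<star> e = e"
proof -
  have neg: "e \<star> n = e" if "n \<in> T" "dl n < 0" for n using kill_opposite e t that by blast
  have b: "\<phi> b \<in> T" "dl (\<phi> b) < 0" using deg_b by simp_all
  have pos: "e \<star> n = e" if "n \<in> T" "dl n > 0" for n
    using sub_iso.kill_opposite[OF flip e b(1) _ neg[OF b] that(1)] b that unfolding flip_dl by simp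
  have ab: "e \<star> \<phi> a = e" "e \<star> \<phi> b = e" using pos neg deg_a deg_b by simp_all
  then have ba: "\<phi> a \<star> e = e" "\<phi> b \<star> e = e" using kill_both[OF e] deg_a deg_b by (metis dl_phi a_A phi_T less_irrefl, metis dl_phi b_A phi_T less_irrefl)
  have "s \<in> gen mT {\<phi> a, \<phi> b}" using s gen_ab_T by simp
  then have "e \<star> s = e \<and> s \<star> e = e"
    by induction (use ab ba in \<open>auto simp: T.assoc, simp flip: T.assoc\<close>)
  then show "e \<star> s = e" "s \<star> e = e" by auto
qed

text \<open>An absorbing \<open>e\<close> is a zero of \<open>T\<close> by \<open>kill_zero\<close>,
  so \<open>e\<close> and \<open>s\<close> generate only \<open>e\<close> and the powers of
  \<open>s\<close>; read in \<open>A\<close>, this makes \<open>h\<close> an identity. Since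
  \<open>\<phi> a\<close> and \<open>\<phi> b\<close> differ from \<open>e\<close> and generate
  \<open>T\<close>, some product of elements other than \<open>e\<close> equals \<open>e\<close>,
  and the signs leave only a positive \<open>s\<close> and a negative \<open>t\<close> with
  \<open>s \<star> t = t \<star> s = e\<close>. Powers of \<open>s\<close> and \<open>t\<close> then
  generate only their own powers and \<open>e\<close>, whereas their preimages in \<open>A\<close>
  generate more.\<close>

lemma no_kill_pos:
  assumes e: "e \<in> T.E" and t: "t \<in> T" "dl t > 0" shows "e \<star> t \<noteq> e"
proof
  assume "e \<star> t = e"
  note zero = kill_zero[OF e t this]
  have eT: "e \<in> T" using e by (rule T.E_S)
  define h where "h = \<psi> e"
  have h: "h \<in> A" "deg h = 0" using eT dl_E[OF e] by (auto simp: h_def dl_def)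
  have gen_zero: "gen mT {e, s} \<subseteq> insert e (gen mT {s})" if "s \<in> T" for s
  proof (rule gen_minimal)
    fix x y assume xy: "x \<in> insert e (gen mT {s})" "y \<in> insert e (gen mT {s})"
    then have "x \<in> T" "y \<in> T" using gen_T[of "{s}"] eT that by auto
    then show "x \<star> y \<in> insert e (gen mT {s})" using xy zero by (auto intro: gen_mult)
  qed (auto intro: gen_base)
  have unit: "h \<odot> x = x \<and> x \<odot> h = x" if x: "x \<in> A" "deg x \<noteq> 0" for x
  proof -
    have "z = x" if z: "z \<in> gen mA {h, x}" "deg z = deg x" for z
    proof -
      have zA: "z \<in> A" using z A.gen_S[of "{h, x}"] x h by auto
      have "\<phi> z \<in> gen mT {e, \<phi> x}" using gen_phi[of "{h, x}" z] z x h eT by (simp add: h_def)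
      then have "\<phi> z = e \<or> \<phi> z \<in> gen mT {\<phi> x}" using gen_zero[of "\<phi> x"] x by auto
      moreover have "\<phi> z \<noteq> e" using z x zA dl_E[OF e] by (metis dl_phi)
      ultimately have "z \<in> gen mA {x}" using gen_psi1[of "\<phi> x" "\<phi> z"] x zA by simp
      then show ?thesis using A.gen_single_eq x z by blast
    qed
    moreover have "deg (h \<odot> x) = deg x" "deg (x \<odot> h) = deg x" using x h by (simp_all add: A.deg_mult)
    moreover have "h \<odot> x \<in> gen mA {h, x}" "x \<odot> h \<in> gen mA {h, x}" by (auto intro: gen_mult gen_base)
    ultimately show ?thesis by blast
  qed
  have unit_right: "x \<odot> h = x" if "x \<in> A" for x
  proof -
    have "x \<in> gen mA {a, b}" using gen_ab that by simp
    then show ?thesis by induction (use unit deg_a deg_b in \<open>auto simp: A.assoc\<close>)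
  qed
  have unit_left: "h \<odot> x = x" if "x \<in> A" for x
  proof -
    have "x \<in> gen mA {a, b}" using gen_ab that by simp
    then show ?thesis by induction (use unit deg_a deg_b in \<open>auto simp flip: A.assoc\<close>)
  qed
  have "\<exists>s\<in>T. \<exists>t\<in>T. dl s > 0 \<and> dl t < 0 \<and> s \<star> t = e \<and> t \<star> s = e"
  proof (rule ccontr)
    assume no: "\<not> ?thesis"
    have swap: "t \<star> s = e" if st: "s \<in> T" "t \<in> T" "s \<star> t = e" for s t
    proof -
      have "t \<star> s \<in> T.E" using rotate st e by metis
      then have "t \<star> s = t \<star> (s \<star> t) \<star> s" using T.E_idem[of "t \<star> s"] by (simp add: T.assoc)
      then show ?thesis using st zero by simp
    qed
    have "s \<star> t \<noteq> e" if st: "s \<in> T - {e}" "t \<in> T - {e}" for s t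
    proof
      assume eq: "s \<star> t = e"
      then have eq': "t \<star> s = e" using swap st by blast
      have dle: "dl e = 0" using e by (rule dl_E)
      consider "dl s = 0" "dl t = 0" | "dl s = 0" "dl t > 0" | "dl s = 0" "dl t < 0"
        | "dl s > 0" "dl t = 0" | "dl s < 0" "dl t = 0" | "dl s > 0" "dl t > 0" | "dl s < 0" "dl t < 0"
        | "dl s > 0" "dl t < 0" | "dl s < 0" "dl t > 0" by linarith
      then show False
      proof cases
        \<comment> \<open>Two idempotents: \<open>h\<close> is a word beginning with
          \<open>\<psi> s\<close> or \<open>\<psi> t\<close>, so that letter fixes \<open>h\<close>
          from the left; as \<open>h\<close> is an identity, the letter is \<open>h\<close>
          itself.\<close>
        case 1
        then have "h \<in> gen mA {\<psi> s, \<psi> t}" using psi_mult[of s t] st eq by (simp add: h_def)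
        then consider "h = \<psi> s \<or> h = \<psi> t" | v where "v \<in> gen mA {\<psi> s, \<psi> t}" "h = \<psi> s \<odot> v"
          | v where "v \<in> gen mA {\<psi> s, \<psi> t}" "h = \<psi> t \<odot> v"
          by (cases rule: A.gen_left_cases) auto
        then show False
        proof cases
          case 1
          then show ?thesis using st eT psi_inj unfolding h_def by auto
        next
          case (2 v)
          have i: "\<psi> s \<odot> \<psi> s = \<psi> s" using \<open>dl s = 0\<close> A.deg_0 st by (simp add: dl_def)
          then have "\<psi> s \<odot> h = h" using 2 by (simp flip: A.assoc)
          then have "\<psi> s = h" using unit_right[of "\<psi> s"] st by simp
          then show ?thesis using st eT psi_inj unfolding h_def by auto
        next
          case (3 v)
          have i: "\<psi> t \<odot> \<psi> t = \<psi> t" using \<open>dl t = 0\<close> A.deg_0 st by (simp add: dl_def)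
          then have "\<psi> t \<odot> h = h" using 3 by (simp flip: A.assoc)
          then have "\<psi> t = h" using unit_right[of "\<psi> t"] st by simp
          then show ?thesis using st eT psi_inj unfolding h_def by auto
        qed
      next
        case 2 then show False using kill_pos(1)[of s t] st eq dle by (auto simp: dl_0_E)
      next
        case 3 then show False using kill_neg(1)[of s t] st eq dle by (auto simp: dl_0_E)
      next
        case 4 then show False using kill_pos(2)[of t s] st eq dle by (auto simp: dl_0_E)
      next
        case 5 then show False using kill_neg(2)[of t s] st eq dle by (auto simp: dl_0_E)
      next
        case 6 then show False using pos_mult[of s t] st eq dle by auto
      next
        case 7 then show False using neg_mult[of s t] st eq dle by auto
      next
        case 8 then show False using no st eq eq' by blast
      next
        case 9 then show False using no st eq eq' by blast
      qed
    qed
    moreover have "\<phi> a \<noteq> e" "\<phi> b \<noteq> e" using dl_E[OF e] deg_a deg_b a_A b_A by (metis dl_phi less_irrefl)+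
    ultimately have "gen mT {\<phi> a, \<phi> b} \<subseteq> T - {e}"
      by (intro gen_minimal) (auto intro: T_closed)
    then show False using gen_ab_T eT by auto
  qed
  then obtain s t where st: "s \<in> T" "t \<in> T" "dl s > 0" "dl t < 0" "s \<star> t = e" "t \<star> s = e" by blast
  have gen_st: "gen mT {s', t'} \<subseteq> insert e (gen mT {s'} \<union> gen mT {t'})"
    if s': "s' \<in> gen mT {s}" and t': "t' \<in> gen mT {t}" for s' t'
  proof -
    have sT: "gen mT {s} \<subseteq> T" "gen mT {t} \<subseteq> T" using st by (auto intro!: gen_T)
    have right: "x \<star> t = e \<and> t \<star> x = e" if "x \<in> gen mT {s}" for x
      using that
    proof induction
      case (gen_mult x y)
      then have "x \<in> T" "y \<in> T" using sT by auto
      have "x \<star> y \<star> t = x \<star> (y \<star> t)" "t \<star> (x \<star> y) = t \<star> x \<star> y" by (simp_all add: T.assoc)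
      then show ?case using gen_mult zero \<open>x \<in> T\<close> \<open>y \<in> T\<close> by simp
    qed (use st in auto)
    have both: "x \<star> y = e \<and> y \<star> x = e" if x: "x \<in> gen mT {s}" and y: "y \<in> gen mT {t}" for x y
      using y
    proof induction
      case (gen_mult y z)
      then have "z \<in> T" "y \<in> T" using sT by auto
      have "x \<star> (y \<star> z) = x \<star> y \<star> z" "y \<star> z \<star> x = y \<star> (z \<star> x)" by (simp_all add: T.assoc)
      then show ?case using gen_mult zero \<open>y \<in> T\<close> \<open>z \<in> T\<close> by simp
    qed (use right[OF x] in auto)
    have sub: "gen mT {s'} \<subseteq> gen mT {s}" "gen mT {t'} \<subseteq> gen mT {t}" using s' t' by (auto intro!: gen_mono)
    show ?thesis
    proof (rule gen_minimal)
      fix x y assume xy: "x \<in> insert e (gen mT {s'} \<union> gen mT {t'})" "y \<in> insert e (gen mT {s'} \<union> gen mT {t'})"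
      then have "x \<in> T" "y \<in> T" using sub sT eT by auto
      moreover have "u \<star> v = e \<and> v \<star> u = e" if "u \<in> gen mT {s'}" "v \<in> gen mT {t'}" for u v
        using both[of u v] sub that by blast
      ultimately show "x \<star> y \<in> insert e (gen mT {s'} \<union> gen mT {t'})"
        using xy zero by (elim insertE UnE) (simp_all add: gen_mult)
    qed (auto intro: gen_base)
  qed
  define x where "x = \<psi> s"
  define y where "y = \<psi> t"
  have xy: "x \<in> A" "y \<in> A" "deg x > 0" "deg y < 0" "\<phi> x = s" "\<phi> y = t"
    using st by (auto simp: x_def y_def dl_def)
  have in_xy: "z = h \<or> z \<in> gen mA {x'} \<or> z \<in> gen mA {y'}"
    if "z \<in> gen mA {x', y'}" "x' \<in> gen mA {x}" "y' \<in> gen mA {y}" for x' y' z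
  proof -
    have A': "x' \<in> A" "y' \<in> A" using that A.gen_S[of "{x}"] A.gen_S[of "{y}"] xy by auto
    then have zA: "z \<in> A" using that A.gen_S[of "{x', y'}"] by auto
    have "\<phi> z \<in> gen mT {\<phi> x', \<phi> y'}" using gen_phi[of "{x', y'}"] A' that by simp
    moreover have "\<phi> x' \<in> gen mT {s}" "\<phi> y' \<in> gen mT {t}"
      using gen_phi[of "{x}" x'] gen_phi[of "{y}" y'] that xy by auto
    ultimately have "\<phi> z = e \<or> \<phi> z \<in> gen mT {\<phi> x'} \<or> \<phi> z \<in> gen mT {\<phi> y'}" using gen_st by blast
    then show ?thesis
    proof (elim disjE)
      assume "\<phi> z = e" then show ?thesis using zA by (auto simp: h_def)
    next
      assume "\<phi> z \<in> gen mT {\<phi> x'}" then show ?thesis using gen_psi1[of "\<phi> x'" "\<phi> z"] zA A' by simp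
    next
      assume "\<phi> z \<in> gen mT {\<phi> y'}" then show ?thesis using gen_psi1[of "\<phi> y'" "\<phi> z"] zA A' by simp
    qed
  qed
  have "deg z \<ge> deg x" if "z \<in> gen mA {x}" for z
  proof -
    obtain k where "deg z = int (Suc k) * deg x" using A.gen_single_deg[OF xy(1) \<open>z \<in> gen mA {x}\<close>] .
    then show ?thesis using xy by (simp add: algebra_simps)
  qed
  moreover have "deg z \<le> deg y" if "z \<in> gen mA {y}" for z
  proof -
    obtain k where "deg z = int (Suc k) * deg y" using A.gen_single_deg[OF xy(2) \<open>z \<in> gen mA {y}\<close>] .
    then show ?thesis using xy by (simp add: algebra_simps mult_nonneg_nonpos)
  qed
  moreover have "deg (x \<odot> y) = deg x + deg y" using xy by (simp add: A.deg_mult)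
  moreover have "x \<odot> y \<in> gen mA {x, y}" by (auto intro: gen_mult gen_base)
  \<comment> \<open>The degree of \<open>x \<odot> y\<close> lies strictly between
    \<open>deg y\<close> and \<open>deg x\<close>, where no power of \<open>x\<close> or
    \<open>y\<close> has its degree; only \<open>h\<close> is left.\<close>
  ultimately have xyh: "x \<odot> y = h" using in_xy[of "x \<odot> y" x y] xy by (force intro: gen_base)
  \<comment> \<open>As \<open>x \<odot> y\<close> is an identity, the fourth power of
    \<open>x\<close> times the third power of \<open>y\<close> is \<open>x\<close>; yet
    \<open>x\<close> is a power neither of its square nor of the negative element
    \<open>y3\<close>.\<close>
  define x2 where "x2 = x \<odot> x"
  define y3 where "y3 = y \<odot> y \<odot> y"
  have x_eq: "x = x2 \<odot> x2 \<odot> y3"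
  proof -
    have c: "x \<odot> (y \<odot> z) = z" if "z \<in> A" for z using xyh unit_left[OF that] by (simp flip: A.assoc)
    have "x2 \<odot> x2 \<odot> y3 = x \<odot> (x \<odot> (x \<odot> (x \<odot> (y \<odot> (y \<odot> y)))))" by (simp add: x2_def y3_def A.assoc)
    also have "\<dots> = x \<odot> h" using xyh xy A.closed by (simp add: c)
    finally show ?thesis using unit_right xy by simp
  qed
  have mem: "x2 \<in> gen mA {x}" "y3 \<in> gen mA {y}" unfolding x2_def y3_def by (auto intro: gen_mult gen_base)
  have A': "x2 \<in> A" "y3 \<in> A" using xy by (auto simp: x2_def y3_def intro: A.closed)
  have "x \<in> gen mA {x2, y3}" by (subst x_eq) (auto intro: gen_mult gen_base)
  then have "x = h \<or> x \<in> gen mA {x2} \<or> x \<in> gen mA {y3}" using in_xy mem by blast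
  moreover have "x \<noteq> h" using xy h by auto
  moreover have "x \<notin> gen mA {x2}"
  proof
    assume "x \<in> gen mA {x2}"
    then obtain k where "deg x = int (Suc k) * deg x2" using A.gen_single_deg[OF A'(1)] by blast
    moreover have "deg x2 = 2 * deg x" using xy by (simp add: x2_def A.deg_mult)
    ultimately have "deg x * (2 * int k + 1) = 0" by (simp add: algebra_simps)
    then show False using xy by auto
  qed
  moreover have "x \<notin> gen mA {y3}"
  proof
    assume "x \<in> gen mA {y3}"
    then obtain k where "deg x = int (Suc k) * deg y3" using A.gen_single_deg[OF A'(2)] by blast
    moreover have "deg y3 = 3 * deg y" using xy by (simp add: y3_def A.deg_mult A.closed)
    ultimately show False using xy by (smt (verit) mult_nonneg_nonpos of_nat_0_le_iff)
  qed
  ultimately show False by blast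
qed

lemma E_pos:
  assumes "e \<in> T.E" "t \<in> T" "dl t > 0"
  shows "dl (e \<star> t) > 0" "dl (t \<star> e) > 0"
proof -
  show "dl (e \<star> t) > 0" using kill_pos no_kill_pos assms by blast
  show "dl (t \<star> e) > 0"
  proof (rule ccontr)
    assume "\<not> dl (t \<star> e) > 0"
    then have "t \<star> e = e" using kill_pos assms by blast
    then have "e \<star> t \<in> T.E" using rotate[of t e] assms T.E_S by metis
    then show False using \<open>dl (e \<star> t) > 0\<close> dl_E by simp
  qed
qed

lemma E_neg:
  assumes "e \<in> T.E" "t \<in> T" "dl t < 0"
  shows "dl (e \<star> t) < 0" "dl (t \<star> e) < 0"
  using sub_iso.E_pos[OF flip, of e t] assms unfolding flip_dl by simp_all

end

section \<open>Products of elements of opposite sign\<close>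

context sub_iso
begin

text \<open>Otherwise \<open>t \<star> s\<close> is negative, and \<open>s \<star> w\<close> is
  idempotent for some word \<open>w\<close> in \<open>s\<close> and \<open>t \<star> s\<close>. But
  \<open>s \<star> (t \<star> s) = (s \<star> t) \<star> s\<close> turns every such
  \<open>s \<star> w\<close> into a product of positive elements.\<close>

lemma sign_commute1:
  assumes s: "s \<in> T" "t \<in> T" "dl s > 0" "dl t < 0" and st: "dl (s \<star> t) > 0" shows "dl (t \<star> s) > 0"
proof (rule ccontr)
  assume "\<not> ?thesis"
  moreover have "t \<star> s \<notin> T.E" using rotate[of t s] s st dl_E by force
  ultimately have neg: "dl (t \<star> s) < 0" using dl_0_E[of "t \<star> s"] T_closed s by force
  let ?n = "t \<star> s"
  have T: "?n \<in> T" "s \<star> t \<in> T" using s by (auto intro: T_closed)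
  then obtain w where w: "w \<in> gen mT {s, ?n}" "s \<star> w \<in> T.E" using opposite_signs[of s ?n] s neg by blast
  have "w \<in> T \<and> dl (s \<star> w) > 0"
    using w(1)
  proof (induction rule: T.gen_left_induct)
    case (base x)
    have "s \<star> ?n = (s \<star> t) \<star> s" by (simp add: T.assoc)
    then have "dl (s \<star> ?n) > 0" using pos_mult[of "s \<star> t" s] T s st by simp
    then show ?case using base s T pos_mult[of s s] by auto
  next
    case (step x w)
    then have sw: "s \<star> w \<in> T" using s T_closed by simp
    have "s \<star> (?n \<star> w) = (s \<star> t) \<star> (s \<star> w)" by (simp add: T.assoc)
    then have "dl (s \<star> (?n \<star> w)) > 0" using pos_mult[of "s \<star> t" "s \<star> w"] T sw st step.IH by simp
    moreover have "dl (s \<star> (s \<star> w)) > 0" using pos_mult[of s "s \<star> w"] s sw step.IH by simp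
    ultimately show ?case using step s T by (auto intro: T_closed)
  qed
  then show False using w dl_E by force
qed

text \<open>The left-right mirror image of \<open>sign_commute1\<close>; the symmetry
  \<open>flip\<close> reverses signs and not the order of factors.\<close>

lemma sign_commute2:
  assumes s: "s \<in> T" "t \<in> T" "dl s > 0" "dl t < 0" and ts: "dl (t \<star> s) > 0" shows "dl (s \<star> t) > 0"
proof (rule ccontr)
  assume "\<not> ?thesis"
  moreover have "s \<star> t \<notin> T.E" using rotate[of s t] s ts dl_E by force
  ultimately have neg: "dl (s \<star> t) < 0" using dl_0_E[of "s \<star> t"] T_closed s by force
  let ?n = "s \<star> t"
  have T: "?n \<in> T" "t \<star> s \<in> T" using s by (auto intro: T_closed)
  then obtain w where w: "w \<in> gen mT {s, ?n}" "s \<star> w \<in> T.E" using opposite_signs[of s ?n] s neg by blast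
  have "w \<in> T \<and> dl (w \<star> s) > 0"
    using w(1)
  proof (induction rule: T.gen_right_induct)
    case (base x)
    have "?n \<star> s = s \<star> (t \<star> s)" by (simp add: T.assoc)
    then have "dl (?n \<star> s) > 0" using pos_mult[of s "t \<star> s"] T s ts by simp
    then show ?case using base s T pos_mult[of s s] by auto
  next
    case (step x w)
    then have sw: "w \<star> s \<in> T" using s T_closed by simp
    have "w \<star> ?n \<star> s = (w \<star> s) \<star> (t \<star> s)" by (simp add: T.assoc)
    then have "dl (w \<star> ?n \<star> s) > 0" using pos_mult[of "w \<star> s" "t \<star> s"] T sw ts step.IH by simp
    moreover have "dl (w \<star> s \<star> s) > 0" using pos_mult[of "w \<star> s" s] s sw step.IH by simp
    ultimately show ?case using step s T by (auto intro: T_closed)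
  qed
  moreover have "w \<star> s \<in> T.E" using rotate[of s w] w s calculation by simp
  ultimately show False using dl_E by force
qed

text \<open>If the product were positive, right multiplication by \<open>\<phi> y\<close> would keep
  every non-idempotent element generated by idempotents and \<open>\<phi> x\<close> positive. By
  \<open>H\<close> these include all positive words in \<open>\<phi> x\<close> and
  \<open>\<phi> y\<close>, so no word beginning with \<open>\<phi> x\<close> could be idempotent,
  against \<open>opposite_signs\<close>.\<close>

lemma product_not_pos:
  assumes x: "x \<in> A" "deg x > 0" and y: "y \<in> A" "deg y < 0"
    and H: "\<And>z. z \<in> gen mA {x, y} \<Longrightarrow> deg z > 0 \<Longrightarrow> z \<in> gen mA (A.E \<union> {x})"
  shows "\<not> dl (\<phi> x \<star> \<phi> y) > 0"
proof
  let ?c = "\<phi> x" and ?d = "\<phi> y"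
  assume cd: "dl (?c \<star> ?d) > 0"
  have c: "?c \<in> T" "dl ?c > 0" and d: "?d \<in> T" "dl ?d < 0" using x y by auto
  have dc: "dl (?d \<star> ?c) > 0" using sign_commute1 c d cd by simp
  have E: "r \<in> T \<and> (r \<in> T.E \<or> dl r > 0 \<and> dl (r \<star> ?d) > 0)" if "r \<in> gen mT (T.E \<union> {?c})" for r
    using that
  proof (induction rule: T.gen_left_induct)
    case (base r)
    then show ?case using c cd T.E_S by auto
  next
    case (step r w)
    have rd: "r \<star> w \<star> ?d = r \<star> (w \<star> ?d)" by (rule T.assoc)
    have wT: "w \<in> T" "w \<star> ?d \<in> T" using step.IH d T_closed by auto
    show ?case
    proof (cases "r \<in> T.E")
      case True
      then show ?thesis using step.IH T.E_mult E_pos(1)[OF True] wT rd T.E_S T_closed by auto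
    next
      case False
      then have r: "r = ?c" using step by simp
      show ?thesis
      proof (cases "w \<in> T.E")
        \<comment> \<open>\<open>w \<star> ?d\<close> is negative, but followed by \<open>?c\<close>
          it is positive; \<open>sign_commute2\<close> moves \<open>?c\<close> to the front.\<close>
        case True
        have "dl (w \<star> ?d) < 0" using E_neg(1)[OF True d] .
        moreover have "dl (w \<star> ?d \<star> ?c) > 0"
          using E_pos(1)[OF True _ dc] T_closed c d by (simp add: T.assoc)
        ultimately have "dl (?c \<star> (w \<star> ?d)) > 0" using sign_commute2 c wT by blast
        moreover have "dl (?c \<star> w) > 0" using E_pos(2)[OF True c] .
        ultimately show ?thesis using r rd c wT T_closed by auto
      next
        case False
        then have "dl w > 0" "dl (w \<star> ?d) > 0" using step.IH by auto
        then show ?thesis using r rd c wT pos_mult T_closed by auto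
      qed
    qed
  qed
  have pos_d: "dl (r \<star> ?d) > 0" if "r \<in> gen mT {?c, ?d}" "dl r > 0" for r
  proof -
    have rT: "r \<in> T" using that gen_T[of "{?c, ?d}"] c d by auto
    have "\<psi> r \<in> gen mA {x, y}" using gen_psi[of "{?c, ?d}" r] that x y by simp
    then have "\<psi> r \<in> gen mA (A.E \<union> {x})" using H that by (simp add: dl_def)
    moreover have sub: "A.E \<union> {x} \<subseteq> A" using x A.E_S by auto
    ultimately have "r \<in> gen mT (\<phi> ` (A.E \<union> {x}))" using gen_phi[OF sub] rT by (metis phi_psi)
    moreover have "\<phi> ` (A.E \<union> {x}) \<subseteq> T.E \<union> {?c}"
      using A.E_S A.deg_0_E by (auto simp flip: dl_0_E)
    then have "gen mT (\<phi> ` (A.E \<union> {x})) \<subseteq> gen mT (T.E \<union> {?c})"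
      by (intro gen_mono) (blast intro: gen_base)
    ultimately have "r \<in> gen mT (T.E \<union> {?c})" by blast
    then show ?thesis using E[of r] that dl_E by fastforce
  qed
  obtain w where w: "w \<in> gen mT {?c, ?d}" "?c \<star> w \<in> T.E" using opposite_signs[of ?c ?d] c d by blast
  have "?c \<star> w \<in> gen mT {?c, ?d} \<and> dl (?c \<star> w) > 0"
    using w(1)
  proof (induction rule: T.gen_right_induct)
    case (base w)
    then show ?case using cd pos_mult[of ?c ?c] c by (auto intro: gen_mult gen_base)
  next
    case (step y w)
    have cw: "?c \<star> w \<in> gen mT {?c, ?d}" "dl (?c \<star> w) > 0" using step.IH by auto
    then have "?c \<star> w \<in> T" using gen_T[of "{?c, ?d}"] c d by auto
    then have "dl (?c \<star> w \<star> y) > 0" using step.hyps pos_d[OF cw] pos_mult[of "?c \<star> w" ?c] c cw by auto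
    moreover have "?c \<star> w \<star> y \<in> gen mT {?c, ?d}" using cw step.hyps by (intro gen_mult) (auto intro: gen_base)
    ultimately show ?case by (simp add: T.assoc)
  qed
  then show False using w dl_E by force
qed

lemma products_idempotent:
  assumes x: "x \<in> A" "deg x > 0" and y: "y \<in> A" "deg y < 0"
    and Hpos: "\<And>z. z \<in> gen mA {x, y} \<Longrightarrow> deg z > 0 \<Longrightarrow> z \<in> gen mA (A.E \<union> {x})"
    and Hneg: "\<And>z. z \<in> gen mA {x, y} \<Longrightarrow> deg z < 0 \<Longrightarrow> z \<in> gen mA (A.E \<union> {y})"
  shows "\<phi> x \<star> \<phi> y \<in> T.E" "\<phi> y \<star> \<phi> x \<in> T.E"
proof -
  interpret f: sub_iso mA A "\<lambda>x. - deg x" mT T \<phi> b a by (rule flip)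
  have 1: "\<not> dl (\<phi> x \<star> \<phi> y) > 0" using product_not_pos assms by blast
  \<comment> \<open>Negating the degree exchanges \<open>x\<close> and \<open>y\<close>, so this
    bounds the product in the other order; \<open>sign_commute2\<close> then carries the bound
    back.\<close>
  have "\<not> f.dl (\<phi> y \<star> \<phi> x) > 0"
    by (rule f.product_not_pos) (use x y Hneg in \<open>auto simp: insert_commute\<close>)
  then have 2: "\<not> dl (\<phi> y \<star> \<phi> x) < 0" by (simp add: flip_dl)
  have "\<not> dl (\<phi> x \<star> \<phi> y) < 0"
    using f.sign_commute2[of "\<phi> y" "\<phi> x"] 2 x y by (auto simp: flip_dl)
  then have "dl (\<phi> x \<star> \<phi> y) = 0" using 1 by simp
  then show *: "\<phi> x \<star> \<phi> y \<in> T.E" using dl_0_E T_closed x y by simp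
  show "\<phi> y \<star> \<phi> x \<in> T.E" by (rule rotate) (use x y * in auto)
qed

section \<open>Words in two elements of \<open>T\<close> with idempotent products\<close>

definition idmaps :: "('b \<Rightarrow> 'b) set" where
  "idmaps = {u. u = id \<or> (\<exists>h\<in>T.E. u = mT h)}"

text \<open>The counterpart of \<open>stab_nest\<close>: \<open>rotate\<close> turns the idempotent
  \<open>h \<star> d \<star> c\<close> into \<open>c \<star> (h \<star> d)\<close>, where
  \<open>conj_E\<close> used that the generators are mutually inverse.\<close>

lemma idmaps_nest:
  assumes c: "c \<in> T" "d \<in> T" "d \<star> c \<in> T.E" "c \<star> d \<in> T.E" and u: "u \<in> idmaps" and v: "v \<in> idmaps"
  shows "u \<circ> mT c \<circ> v \<circ> mT d \<in> idmaps"
proof -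
  have "\<exists>g\<in>T.E. mT c \<circ> v \<circ> mT d = mT g"
  proof (cases "v = id")
    case True
    then have "mT c \<circ> v \<circ> mT d = mT (c \<star> d)" by (simp add: fun_eq_iff T.assoc)
    then show ?thesis using c by blast
  next
    case False
    then obtain h where h: "h \<in> T.E" "v = mT h" using v by (auto simp: idmaps_def)
    have "h \<star> (d \<star> c) \<in> T.E" using h(1) c(3) by (rule T.E_mult)
    then have "h \<star> d \<star> c \<in> T.E" by (simp add: T.assoc)
    then have "c \<star> (h \<star> d) \<in> T.E" using rotate[of "h \<star> d" c] h c T_closed T.E_S by simp
    moreover have "mT c \<circ> v \<circ> mT d = mT (c \<star> (h \<star> d))" using h(2) by (simp add: fun_eq_iff T.assoc)
    ultimately show ?thesis by blast
  qed
  then obtain g where g: "g \<in> T.E" "mT c \<circ> v \<circ> mT d = mT g" by blast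
  have eq: "u \<circ> mT c \<circ> v \<circ> mT d = u \<circ> mT g" unfolding g(2)[symmetric] by (simp add: comp_assoc)
  show ?thesis
  proof (cases "u = id")
    case True
    then show ?thesis unfolding eq using g by (auto simp: idmaps_def)
  next
    case False
    then obtain h where h: "h \<in> T.E" "u = mT h" using u by (auto simp: idmaps_def)
    then have "u \<circ> mT g = mT (h \<star> g)" by (simp add: fun_eq_iff T.assoc)
    moreover have "h \<star> g \<in> T.E" using h g by (intro T.E_mult)
    ultimately show ?thesis unfolding eq idmaps_def by blast
  qed
qed

lemma id_idmaps: "id \<in> idmaps"
  by (simp add: idmaps_def)

text \<open>A word of degree \<open>n > 0\<close> is a product of \<open>n\<close> letters \<open>c\<close> and idempotents, split at the last visits
  to the heights \<open>0, \<dots>, n - 1\<close>.\<close>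

lemma dg_Pre_idmaps:
  assumes c: "c \<in> T" "d \<in> T" "c \<star> d \<in> T.E" "d \<star> c \<in> T.E" and w: "T.dg c d w n"
  shows "(n \<ge> 0 \<longrightarrow> T.Pre idmaps c (nat n) (mT w)) \<and> (n \<le> 0 \<longrightarrow> T.Pre idmaps d (nat (- n)) (mT w))"
proof -
  note cd = idmaps_nest[OF c(1,2,4,3)] and dc = idmaps_nest[OF c(2,1,3,4)]
  have comp: "mT (w \<star> x) = mT w \<circ> mT x" for w x by (simp add: fun_eq_iff T.assoc)
  show ?thesis using w
  proof (induction rule: T.dg.induct)
    case dg_a
    show ?case using T.Pre_snoc_a[OF id_idmaps T.Pre_0[OF id_idmaps], of c] by (simp only: id_comp) simp
  next
    case dg_b
    show ?case using T.Pre_snoc_a[OF id_idmaps T.Pre_0[OF id_idmaps], of d] by (simp only: id_comp) simp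
  next
    case (dg_xa x n)
    have "T.Pre idmaps c (nat (n + 1)) (mT (x \<star> c))" if "n + 1 \<ge> 0"
    proof (cases "n \<ge> 0")
      case True
      then have "T.Pre idmaps c (Suc (nat n)) (mT x \<circ> mT c)"
        using dg_xa.IH by (intro T.Pre_snoc_a id_idmaps) simp
      moreover have "Suc (nat n) = nat (n + 1)" using True by simp
      ultimately show ?thesis unfolding comp by metis
    next
      case False
      then have n: "n = -1" using that by simp
      then have "T.Pre idmaps d (Suc 0) (mT x)" using dg_xa.IH by simp
      from T.Pre_snoc_b[OF dc this] show ?thesis unfolding comp using n by (simp add: T.Pre_0_iff)
    qed
    moreover have "T.Pre idmaps d (nat (- (n + 1))) (mT (x \<star> c))" if "n + 1 \<le> 0"
    proof -
      have "Suc (nat (- (n + 1))) = nat (- n)" using that by simp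
      then have "T.Pre idmaps d (Suc (nat (- (n + 1)))) (mT x)" using dg_xa.IH that by simp
      from T.Pre_snoc_b[OF dc this] show ?thesis unfolding comp .
    qed
    ultimately show ?case by blast
  next
    case (dg_xb x n)
    have "T.Pre idmaps d (nat (- (n - 1))) (mT (x \<star> d))" if "n - 1 \<le> 0"
    proof (cases "n \<le> 0")
      case True
      then have "T.Pre idmaps d (Suc (nat (- n))) (mT x \<circ> mT d)"
        using dg_xb.IH by (intro T.Pre_snoc_a id_idmaps) simp
      moreover have "Suc (nat (- n)) = nat (- (n - 1))" using True by simp
      ultimately show ?thesis unfolding comp by metis
    next
      case False
      then have n: "n = 1" using that by simp
      then have "T.Pre idmaps c (Suc 0) (mT x)" using dg_xb.IH by simp
      from T.Pre_snoc_b[OF cd this] show ?thesis unfolding comp using n by (simp add: T.Pre_0_iff)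
    qed
    moreover have "T.Pre idmaps c (nat (n - 1)) (mT (x \<star> d))" if "n - 1 \<ge> 0"
    proof -
      have "Suc (nat (n - 1)) = nat n" using that by simp
      then have "T.Pre idmaps c (Suc (nat (n - 1))) (mT x)" using dg_xb.IH that by simp
      from T.Pre_snoc_b[OF cd this] show ?thesis unfolding comp .
    qed
    ultimately show ?case by blast
  qed
qed

text \<open>Replaces additivity of the degree: a word with an unclosed letter \<open>c\<close> sends
  idempotents to positive elements, so it cannot itself be idempotent.\<close>

lemma Pre_pos:
  assumes "T.Pre idmaps c k g" "c \<in> T" "dl c > 0" "t \<in> T" "dl t \<ge> 0"
  shows "g t \<in> T \<and> dl (g t) \<ge> 0 \<and> (k > 0 \<or> dl t > 0 \<longrightarrow> dl (g t) > 0)"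
  using assms(1,4,5)
proof (induction arbitrary: t rule: T.Pre.induct)
  have idm: "u t \<in> T \<and> dl (u t) \<ge> 0 \<and> (dl t > 0 \<longrightarrow> dl (u t) > 0)"
    if u: "u \<in> idmaps" and "t \<in> T" "dl t \<ge> 0" for u t
  proof (cases "u = id")
    case False
    then obtain h where h: "h \<in> T.E" "u = mT h" using u by (auto simp: idmaps_def)
    have "dl (h \<star> t) = 0" if "dl t = 0" using dl_0_mult h(1) that \<open>t \<in> T\<close> dl_E T.E_S by blast
    moreover have "dl (h \<star> t) > 0" if "dl t > 0" using E_pos(1) h(1) that \<open>t \<in> T\<close> by blast
    ultimately show ?thesis using that h T_closed T.E_S by (cases "dl t = 0") auto
  qed (use that in simp)
  {
    case (Pre_0 u)
    then show ?case using idm by simp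
  next
    case (Pre_Suc k g u)
    have u: "u t \<in> T" "dl (u t) \<ge> 0" using idm Pre_Suc by auto
    have "dl (c \<star> u t) > 0"
    proof (cases "dl (u t) = 0")
      case True
      then have "u t \<in> T.E" using dl_0_E u by blast
      then show ?thesis using E_pos(2) assms by blast
    next
      case False
      then show ?thesis using pos_mult assms u by simp
    qed
    moreover have "c \<star> u t \<in> T" using u assms T_closed by simp
    ultimately show ?case using Pre_Suc.IH[of "c \<star> u t"] by simp
  }
qed

text \<open>As \<open>\<phi> a \<star> z\<close> is idempotent, \<open>z\<close> has degree
  \<open>-1\<close> as a word, hence is a single \<open>\<phi> b\<close> between idempotents or
  empty words. So the idempotent \<open>z \<star> \<phi> a\<close> lies below
  \<open>\<phi> b \<star> \<phi> a\<close> in the order of rectangular components, and the latter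
  can be inserted after \<open>\<phi> a\<close>.\<close>

lemma regular_imp_inverse:
  assumes cd: "\<phi> a \<star> \<phi> b \<in> T.E" "\<phi> b \<star> \<phi> a \<in> T.E"
    and z: "z \<in> T" "\<phi> a \<star> z \<star> \<phi> a = \<phi> a"
  shows "\<phi> a \<star> \<phi> b \<star> \<phi> a = \<phi> a"
proof -
  interpret f: sub_iso mA A "\<lambda>x. - deg x" mT T \<phi> b a by (rule flip)
  let ?c = "\<phi> a" and ?d = "\<phi> b"
  have c: "?c \<in> T" "dl ?c > 0" and d: "?d \<in> T" "dl ?d < 0" using deg_a deg_b by auto
  obtain n where n: "T.dg ?c ?d z n" using T.dg_exists[of z] z gen_ab_T by auto
  have cz: "?c \<star> z \<in> T.E" using z c T_closed by (simp add: T.E_iff flip: T.assoc)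
  have dg_cz: "T.dg ?c ?d (?c \<star> z) (1 + n)" by (rule T.dg_mult[OF n T.dg_a])
  note P = dg_Pre_idmaps[OF c(1) d(1) cd dg_cz]
  have czE: "?c \<star> z \<star> (?c \<star> z) = ?c \<star> z" "dl (?c \<star> z) = 0" "?c \<star> z \<in> T"
    using cz T.E_idem dl_E T.E_S by auto
  have "\<not> 1 + n > 0"
  proof
    assume "1 + n > 0"
    then have "T.Pre idmaps ?c (nat (1 + n)) (mT (?c \<star> z))" "nat (1 + n) > 0" using P by auto
    then have "dl (?c \<star> z \<star> (?c \<star> z)) > 0" using Pre_pos[OF _ c czE(3)] czE(2) by (metis order_refl)
    then show False using czE by simp
  qed
  moreover have "\<not> 1 + n < 0"
  proof
    assume "1 + n < 0"
    then have "T.Pre idmaps ?d (nat (- (1 + n))) (mT (?c \<star> z))" "nat (- (1 + n)) > 0" using P by auto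
    then have "f.dl (?c \<star> z \<star> (?c \<star> z)) > 0"
      using f.Pre_pos[of ?d _ "mT (?c \<star> z)" "?c \<star> z"] d czE
      by (metis flip_dl neg_0_less_iff_less neg_0_le_iff_le order_refl)
    then show False using czE by (simp add: flip_dl)
  qed
  ultimately have "n = -1" by linarith
  then have "T.Pre idmaps ?d (Suc 0) (mT z)" using dg_Pre_idmaps[OF c(1) d(1) cd n] by simp
  then obtain u v where uv: "u \<in> idmaps" "v \<in> idmaps" "mT z = u \<circ> mT ?d \<circ> v"
    by (cases rule: T.Pre.cases) (auto simp: T.Pre_0_iff)
  define \<eta> where "\<eta> = ?d \<star> ?c"
  define \<theta> where "\<theta> = ?d \<star> v ?c"
  have \<eta>: "\<eta> \<in> T.E" unfolding \<eta>_def by (rule cd)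
  have \<theta>: "\<theta> \<in> T.E \<and> \<theta> \<star> \<eta> \<star> \<theta> = \<theta>"
  proof (cases "v = id")
    case True
    then have "\<theta> = \<eta>" by (simp add: \<theta>_def \<eta>_def)
    then show ?thesis using \<eta> T.E_idem by simp
  next
    case False
    then obtain h where h: "h \<in> T.E" "v = mT h" using uv by (auto simp: idmaps_def)
    have "h \<star> (?c \<star> ?d) \<in> T.E" using h(1) cd(1) by (rule T.E_mult)
    then have "(h \<star> ?c) \<star> ?d \<in> T.E" by (simp add: T.assoc)
    then have "\<theta> \<in> T.E" using rotate[of "h \<star> ?c" ?d] h c d T_closed T.E_S by (simp add: \<theta>_def)
    moreover have "\<theta> \<star> \<eta> \<star> \<theta> = ?d \<star> (h \<star> ((?c \<star> ?d) \<star> (?c \<star> ?d)) \<star> h \<star> ?c)"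
      using h(2) by (simp add: \<theta>_def \<eta>_def T.assoc)
    moreover have "\<dots> = \<theta> \<star> \<theta>" unfolding T.E_idem[OF cd(1)] using h(2) by (simp add: \<theta>_def T.assoc)
    ultimately show ?thesis using T.E_idem by metis
  qed
  define \<kappa> where "\<kappa> = z \<star> ?c"
  have "\<kappa> = (u \<circ> mT ?d \<circ> v) ?c" unfolding \<kappa>_def using uv(3) by (rule fun_cong)
  then have \<kappa>u: "\<kappa> = u \<theta>" by (simp add: \<theta>_def)
  have "\<exists>p\<in>T.E. \<kappa> = p \<star> \<eta> \<star> \<theta>"
  proof (cases "u = id")
    case True
    then show ?thesis using \<kappa>u \<theta> by (metis id_apply)
  next
    case False
    then obtain h where h: "h \<in> T.E" "u = mT h" using uv by (auto simp: idmaps_def)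
    then have "\<kappa> = h \<star> (\<theta> \<star> \<eta> \<star> \<theta>)" using \<kappa>u \<theta> by simp
    then have "\<kappa> = (h \<star> \<theta>) \<star> \<eta> \<star> \<theta>" by (simp add: T.assoc)
    moreover have "h \<star> \<theta> \<in> T.E" using h \<theta> T.E_mult by blast
    ultimately show ?thesis by blast
  qed
  then obtain p where p: "p \<in> T.E" "\<kappa> = p \<star> \<eta> \<star> \<theta>" by blast
  have \<kappa>\<eta>: "\<kappa> \<star> \<eta> \<star> \<kappa> = \<kappa>" unfolding p(2) using T.band_sandwich p(1) \<eta> \<theta> by blast
  have c\<kappa>: "?c \<star> \<kappa> = ?c" using z(2) by (simp add: \<kappa>_def T.assoc)
  have "?c \<star> (\<kappa> \<star> \<eta> \<star> \<kappa>) = ?c" unfolding \<kappa>\<eta> by (rule c\<kappa>)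
  then have c\<eta>\<kappa>: "?c \<star> \<eta> \<star> \<kappa> = ?c" using c\<kappa> by (simp flip: T.assoc)
  have "?c \<star> ?d \<star> ?c = ?c \<star> ?d \<star> (?c \<star> \<eta> \<star> \<kappa>)" unfolding c\<eta>\<kappa> ..
  also have "\<dots> = ?c \<star> (\<eta> \<star> \<eta>) \<star> \<kappa>" by (simp add: \<eta>_def T.assoc)
  also have "\<dots> = ?c" unfolding T.E_idem[OF \<eta>] by (rule c\<eta>\<kappa>)
  finally show ?thesis .
qed

end

section \<open>The images of the generators\<close>

locale orthodox_iso = sub_iso +
  assumes aba: "a \<odot> b \<odot> a = a" and bab: "b \<odot> a \<odot> b = b" and deg_a1: "deg a = 1"
begin

lemma flip_orthodox: "orthodox_iso mA A (\<lambda>x. - deg x) mT T \<phi> b a"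
proof -
  interpret f: sub_iso mA A "\<lambda>x. - deg x" mT T \<phi> b a by (rule flip)
  have "deg (a \<odot> b \<odot> a) = deg a" by (simp add: aba)
  then have "deg b = -1" using deg_a1 by (simp add: A.deg_mult A.closed)
  then show ?thesis by unfold_locales (use aba bab in simp_all)
qed

sublocale P: inverse_pair mA A a b
  by unfold_locales (use aba bab in simp_all)

lemma deg_b1: "deg b = -1"
proof -
  have "deg (a \<odot> b \<odot> a) = deg a" by (simp add: aba)
  then show ?thesis using deg_a1 by (simp add: A.deg_mult A.closed)
qed

lemma deg_E: "x \<in> A.E \<Longrightarrow> deg x = 0"
  using A.deg_0_E A.E_S by blast

lemma dg_deg: 
  assumes x: "x \<in> A" "y \<in> A" "deg x = 1" "deg y = -1"
  shows "A.dg x y z n \<Longrightarrow> z \<in> A \<and> deg z = n"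
  by (induction rule: A.dg.induct) (use x in \<open>auto simp: A.deg_mult A.closed\<close>)

text \<open>Stated for an arbitrary pair because it is applied to \<open>a\<close>, \<open>b\<close>
  and again to \<open>a1\<close>, \<open>b1\<close> in \<open>comparable_inverse\<close>.\<close>

lemma pair_products_idempotent:
  assumes p: "inverse_pair mA A x y" and d: "deg x = 1" "deg y = -1"
  shows "\<phi> x \<star> \<phi> y \<in> T.E" "\<phi> y \<star> \<phi> x \<in> T.E"
proof -
  interpret p: inverse_pair mA A x y by (rule p)
  interpret q: inverse_pair mA A y x by (rule p.swap)
  have "z \<in> gen mA (A.E \<union> {x})" if z: "z \<in> gen mA {x, y}" and "deg z > 0" for z
  proof -
    obtain n where n: "A.dg x y z n" using A.dg_exists[OF z] by blast
    then have "n = deg z" using dg_deg[OF _ _ d] by simp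
    then show ?thesis using p.dg_pos_gen[OF n] that by simp
  qed
  moreover have "z \<in> gen mA (A.E \<union> {y})" if z: "z \<in> gen mA {x, y}" and "deg z < 0" for z
  proof -
    obtain n where n: "A.dg x y z n" using A.dg_exists[OF z] by blast
    then have "n = deg z" using dg_deg[OF _ _ d] by simp
    then show ?thesis using q.dg_pos_gen[OF A.dg_swap[OF n]] that by simp
  qed
  ultimately show "\<phi> x \<star> \<phi> y \<in> T.E" "\<phi> y \<star> \<phi> x \<in> T.E"
    using products_idempotent[of x y] d by simp_all
qed

lemma ab_T_E: "\<phi> a \<star> \<phi> b \<in> T.E" "\<phi> b \<star> \<phi> a \<in> T.E"
  using pair_products_idempotent[OF P.inverse_pair_axioms] deg_a1 deg_b1 by simp_all

abbreviation "e \<equiv> a \<odot> b"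
abbreviation "f \<equiv> b \<odot> a"

text \<open>The principal ideal of \<open>a \<odot> a\<close>: outer factors from \<open>A\<close>
  suffice since \<open>a \<odot> a = e \<odot> (a \<odot> a) \<odot> f\<close>. Its complement lies
  in \<open>{a, b, e, f}\<close> (\<open>I_or\<close>).\<close>

definition I :: "'a set" where
  "I = {p \<odot> (a \<odot> a) \<odot> q | p q. p \<in> A \<and> q \<in> A}"

lemma I_A: "I \<subseteq> A"
  by (auto simp: I_def intro!: A.closed)

lemma I_left: "x \<in> A \<Longrightarrow> i \<in> I \<Longrightarrow> x \<odot> i \<in> I"
proof -
  assume x: "x \<in> A" "i \<in> I"
  then obtain p q where "p \<in> A" "q \<in> A" "i = p \<odot> (a \<odot> a) \<odot> q" by (auto simp: I_def)
  moreover from this have "x \<odot> i = (x \<odot> p) \<odot> (a \<odot> a) \<odot> q" by (simp add: A.assoc)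
  ultimately show ?thesis using x A.closed unfolding I_def by blast
qed

lemma I_right: "x \<in> A \<Longrightarrow> i \<in> I \<Longrightarrow> i \<odot> x \<in> I"
proof -
  assume x: "x \<in> A" "i \<in> I"
  then obtain p q where "p \<in> A" "q \<in> A" "i = p \<odot> (a \<odot> a) \<odot> q" by (auto simp: I_def)
  moreover from this have "i \<odot> x = p \<odot> (a \<odot> a) \<odot> (q \<odot> x)" by (simp add: A.assoc)
  ultimately show ?thesis using x A.closed unfolding I_def by blast
qed

lemma aa_I: "a \<odot> a \<in> I"
proof -
  have "a \<odot> a = e \<odot> (a \<odot> a) \<odot> f" using aba P.aba' by (simp add: A.assoc P.aba_left)
  then show ?thesis unfolding I_def using A.closed a_A b_A by blast
qed

lemma bb_I: "b \<odot> b \<in> I"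
proof -
  have "A.pw b 1 \<odot> A.pw a 1 \<odot> A.pw b 1 = A.pw b 1"
    using inverse_pair.pw_inverse[OF P.swap] .
  then have "b \<odot> b = b \<odot> b \<odot> (a \<odot> a) \<odot> (b \<odot> b)" by simp
  then show ?thesis unfolding I_def using A.closed b_A by blast
qed

lemma I_or: "x \<in> A \<Longrightarrow> x \<in> I \<or> x \<in> {a, b, e, f}"
proof -
  assume "x \<in> A"
  then have "x \<in> gen mA {a, b}" using gen_ab by simp
  then show ?thesis
  proof (induction rule: A.gen_right_induct)
    case (step x w)
    have "a \<odot> b \<odot> b \<in> I" "b \<odot> a \<odot> a \<in> I"
      using I_left[OF a_A bb_I] I_left[OF b_A aa_I] by (simp_all add: A.assoc)
    then show ?case using step aa_I bb_I I_right[of x w] aba bab by auto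
  qed auto
qed

text \<open>In the cycle \<open>a\<close>, \<open>e\<close>, \<open>b\<close>, \<open>f\<close>,
  \<open>a\<close> each element is a multiple of its predecessor.\<close>

lemma e_I_iff: "f \<in> I \<longleftrightarrow> e \<in> I" "a \<in> I \<longleftrightarrow> e \<in> I" "b \<in> I \<longleftrightarrow> e \<in> I"
proof -
  have 1: "a \<in> I \<Longrightarrow> e \<in> I" using I_right[OF b_A] .
  have 2: "f \<in> I \<Longrightarrow> a \<in> I" using I_left[OF a_A, of f] P.aba' by simp
  have 3: "b \<in> I \<Longrightarrow> f \<in> I" using I_right[OF a_A, of b] .
  have 4: "e \<in> I \<Longrightarrow> b \<in> I" using I_left[OF b_A, of e] P.bab' by simp
  show "f \<in> I \<longleftrightarrow> e \<in> I" "a \<in> I \<longleftrightarrow> e \<in> I" "b \<in> I \<longleftrightarrow> e \<in> I" using 1 2 3 4 by blast+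
qed

lemma e_A: "e \<in> A" and f_A: "f \<in> A" and deg_e: "deg e = 0" and deg_f: "deg f = 0"
  using deg_a1 deg_b1 by (simp_all add: A.closed A.deg_mult)

lemma complement_closed:
  assumes "\<And>x y. x \<in> A - R \<Longrightarrow> y \<in> A - R \<Longrightarrow> x \<odot> y \<notin> R"
    and st: "s \<in> T" "t \<in> T" "s \<notin> \<phi> ` R" "t \<notin> \<phi> ` R" and R: "R \<subseteq> A"
  shows "s \<star> t \<notin> \<phi> ` R"
proof -
  have "gen mA (A - R) \<subseteq> A - R" by (rule gen_minimal) (use assms(1) A.closed in auto)
  moreover have "\<psi> s \<in> A - R" "\<psi> t \<in> A - R" using st by (metis DiffI imageI phi_psi psi_A)+
  then have "gen mA {\<psi> s, \<psi> t} \<subseteq> gen mA (A - R)" by (intro gen_mono) (auto intro: gen_base)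
  ultimately have "\<psi> (s \<star> t) \<in> A - R" using psi_mult st by blast
  then show ?thesis using R by (metis DiffD2 image_iff psi_phi subsetD)
qed

text \<open>If \<open>e\<close> is not in the ideal generated by \<open>a\<^sup>2\<close>, then the complements of \<open>{a, e}\<close> and \<open>{b, e}\<close> are
  subsemigroups but that of \<open>{e}\<close> is not, which forces \<open>\<phi> e\<close> to be a product of \<open>\<phi> a\<close> and \<open>\<phi> b\<close>.\<close>

lemma image_e:
  assumes eI: "e \<notin> I" shows "\<phi> e \<in> {\<phi> a \<star> \<phi> b, \<phi> b \<star> \<phi> a}"
proof -
  have nI: "a \<notin> I" "b \<notin> I" "f \<notin> I" using eI e_I_iff by auto
  have ne: "a \<noteq> b" "e \<noteq> a" "e \<noteq> b" "f \<noteq> a" "f \<noteq> b"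
    using deg_a1 deg_b1 deg_e deg_f by auto
  have "e \<noteq> f"
  proof
    assume "e = f"
    then have "a = f \<odot> a" using aba by simp
    then have "a \<in> I" using I_left[OF b_A aa_I] by (simp add: A.assoc)
    then show False using nI by simp
  qed
  have ae: "x \<odot> y \<notin> {a, e}" if "x \<in> A - {a, e}" "y \<in> A - {a, e}" for x y
  proof -
    have "x \<in> I \<union> {b, f}" "y \<in> I \<union> {b, f}" using that I_or by auto
    moreover have "b \<odot> f \<in> I" using I_right[OF a_A bb_I] by (simp add: A.assoc)
    moreover have "f \<odot> f = f" "f \<odot> b = b" using A.E_idem[OF P.ba_E] bab by simp_all
    ultimately have "x \<odot> y \<in> I \<union> {b, f}" using I_left[of x y] I_right[of y x] bb_I that by auto
    then show ?thesis using nI eI ne \<open>e \<noteq> f\<close> by auto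
  qed
  have be: "x \<odot> y \<notin> {b, e}" if "x \<in> A - {b, e}" "y \<in> A - {b, e}" for x y
  proof -
    have "x \<in> I \<union> {a, f}" "y \<in> I \<union> {a, f}" using that I_or by auto
    moreover have "f \<odot> a \<in> I" using I_left[OF b_A aa_I] by (simp add: A.assoc)
    moreover have "f \<odot> f = f" "a \<odot> f = a" using A.E_idem[OF P.ba_E] P.aba' by simp_all
    ultimately have "x \<odot> y \<in> I \<union> {a, f}" using I_left[of x y] I_right[of y x] aa_I that by auto
    then show ?thesis using nI eI ne \<open>e \<noteq> f\<close> by auto
  qed
  have "\<exists>s\<in>T. \<exists>t\<in>T. s \<noteq> \<phi> e \<and> t \<noteq> \<phi> e \<and> s \<star> t = \<phi> e"
  proof (rule ccontr)
    assume "\<not> ?thesis"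
    then have "gen mT (T - {\<phi> e}) \<subseteq> T - {\<phi> e}" by (intro gen_minimal) (auto intro: T_closed)
    moreover have "\<phi> a \<in> T - {\<phi> e}" "\<phi> b \<in> T - {\<phi> e}" using ne psi_phi[OF e_A] by (metis Diff_iff a_A b_A phi_T psi_phi singletonD)+
    then have "gen mT {\<phi> a, \<phi> b} \<subseteq> gen mT (T - {\<phi> e})" by (intro gen_mono) (auto intro: gen_base)
    ultimately have "T \<subseteq> T - {\<phi> e}" unfolding gen_ab_T by (rule subset_trans[rotated])
    then show False using phi_T[OF e_A] by blast
  qed
  then obtain s t where st: "s \<in> T" "t \<in> T" "s \<noteq> \<phi> e" "t \<noteq> \<phi> e" "s \<star> t = \<phi> e" by blast
  have "s = \<phi> a \<or> t = \<phi> a" using complement_closed[OF ae, of s t] st e_A by auto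
  moreover have "s = \<phi> b \<or> t = \<phi> b" using complement_closed[OF be, of s t] st e_A by auto
  moreover have "\<phi> a \<noteq> \<phi> b" using ne by (metis a_A b_A psi_phi)
  ultimately show ?thesis using st by auto
qed

text \<open>If \<open>?u\<close> differs from \<open>\<phi> a\<close>, its preimage is positive and
  not \<open>a\<close>, hence in \<open>I\<close>. Since
  \<open>\<phi> a \<star> \<phi> b = ?u \<star> \<phi> b\<close>, the preimage of this product,
  \<open>e\<close> or \<open>f\<close>, would lie in \<open>I\<close> or be a power of
  \<open>b\<close>.\<close>

lemma not_in_I_inverse:
  assumes eI: "e \<notin> I" and ef: "\<phi> a \<star> \<phi> b \<in> {\<phi> e, \<phi> f}"
  shows "\<phi> a \<star> \<phi> b \<star> \<phi> a = \<phi> a"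
proof (rule ccontr)
  let ?c = "\<phi> a" and ?d = "\<phi> b" let ?u = "?c \<star> ?d \<star> ?c"
  assume u: "?u \<noteq> ?c"
  have uT: "?u \<in> T" by (intro T_closed) auto
  have "dl ?u > 0" using E_pos(1)[OF ab_T_E(1), of ?c] deg_a by simp
  moreover have "\<psi> ?u \<in> A" using uT by simp
  ultimately have "\<psi> ?u \<in> I" using I_or[of "\<psi> ?u"] u deg_b1 deg_e deg_f phi_psi[OF uT] by (auto simp: dl_def)
  define w where "w = \<psi> (?c \<star> ?d)"
  have w: "w \<in> {e, f}" using ef e_A f_A by (auto simp: w_def)
  have "?c \<star> ?d = ?u \<star> ?d" using T.E_idem[OF ab_T_E(1)] by (simp add: T.assoc)
  then have "w \<in> gen mA {\<psi> ?u, b}" using psi_mult[OF uT, of ?d] unfolding w_def by simp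
  also have "\<dots> \<subseteq> I \<union> gen mA {b}"
  proof (rule gen_minimal)
    fix x y assume xy: "x \<in> I \<union> gen mA {b}" "y \<in> I \<union> gen mA {b}"
    moreover have "gen mA {b} \<subseteq> A" by (rule A.gen_S) simp
    ultimately show "x \<odot> y \<in> I \<union> gen mA {b}" using I_left[of x y] I_right[of y x] I_A by (auto intro: gen_mult)
  qed (use \<open>\<psi> ?u \<in> I\<close> in \<open>auto intro: gen_base\<close>)
  finally have "w \<in> gen mA {b}" using w eI e_I_iff by auto
  then obtain k where "deg w = int (Suc k) * deg b" using A.gen_single_deg[OF b_A] by blast
  then show False using w deg_e deg_f deg_b1 by auto
qed

text \<open>Write \<open>e = p \<odot> (a \<odot> a) \<odot> q\<close>. If \<open>deg p < 0\<close>,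
  factoring \<open>p\<close> exposes a letter \<open>b\<close>, where \<open>f\<close> fits in;
  otherwise \<open>f = b \<odot> e \<odot> a\<close> has a letter \<open>a\<close> preceded by a
  part of degree \<open>0\<close>, where \<open>e\<close> fits in. Either way one of
  \<open>e\<close>, \<open>f\<close> is a product of idempotents with the other in the middle, and
  \<open>band_sandwich\<close> applies.\<close>

lemma in_I_comparable:
  assumes "e \<in> I" shows "e \<odot> f \<odot> e = e \<or> f \<odot> e \<odot> f = f"
proof -
  obtain p q where pq: "p \<in> A" "q \<in> A" "e = p \<odot> (a \<odot> a) \<odot> q" using assms by (auto simp: I_def)
  have factor: "\<exists>g\<in>A.E. \<exists>h\<in>A.E. \<exists>k. int (Suc k) = deg x \<and> x = g \<odot> A.pw a k \<odot> h" if x: "x \<in> A" "deg x > 0" for x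
  proof -
    obtain n where n: "A.dg a b x n" using A.dg_exists[of x] x gen_ab by auto
    then have "n = deg x" using dg_deg[OF a_A b_A deg_a1 deg_b1] by simp
    moreover obtain k where "deg x = int (Suc k)" using x by (metis gr0_implies_Suc pos_int_cases)
    ultimately show ?thesis using P.dg_factor[of x k] n by metis
  qed
  have factor_b: "\<exists>g\<in>A.E. \<exists>h\<in>A.E. \<exists>k. x = g \<odot> A.pw b k \<odot> h" if x: "x \<in> A" "deg x < 0" for x
  proof -
    obtain n where n: "A.dg a b x n" using A.dg_exists[of x] x gen_ab by auto
    then have "n = deg x" using dg_deg[OF a_A b_A deg_a1 deg_b1] by simp
    moreover obtain k where "- deg x = int (Suc k)" using x by (metis gr0_implies_Suc neg_0_less_iff_less pos_int_cases)
    ultimately show ?thesis using inverse_pair.dg_factor[OF P.swap, of x k] A.dg_swap[OF n] by metis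
  qed
  have E0: "x \<in> A.E" if "x \<in> A" "deg x = 0" for x using A.deg_0_E that by blast
  have degs: "deg p + 2 + deg q = 0"
    using arg_cong[OF pq(3), of deg] pq deg_e deg_a1 by (simp add: A.deg_mult A.closed)
  have eE: "e \<in> A.E" and fE: "f \<in> A.E" by auto
  have fpq: "f = b \<odot> p \<odot> a \<odot> (a \<odot> q \<odot> a)"
  proof -
    have "f = b \<odot> e \<odot> a" by (simp add: A.assoc P.aba' )
    then show ?thesis unfolding pq(3) by (simp add: A.assoc)
  qed
  have below: "f \<odot> e \<odot> f = f" if "f = x \<odot> e \<odot> y" "x \<in> A.E" "y \<in> A.E" for x y
    using A.band_sandwich[OF that(2) eE that(3)] that(1) by metis
  have ea: "e \<odot> (a \<odot> x) = a \<odot> x" for x using P.aba_left by (simp add: A.assoc)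
  consider "deg p < 0" | "deg p = 0" | "deg p = 1" | "deg p > 1" by linarith
  then show ?thesis
  proof cases
    case 1
    then obtain g h k where ghk: "g \<in> A.E" "h \<in> A.E" "p = g \<odot> A.pw b k \<odot> h" using factor_b pq by blast
    define r where "r = A.pw b k \<odot> h \<odot> (a \<odot> a) \<odot> q"
    have er: "e = g \<odot> r" using pq(3) ghk(3) by (simp add: r_def A.assoc)
    have rA: "r \<in> A" unfolding r_def using ghk pq A.E_S by (intro A.closed A.pw_S) auto
    have "deg r = 0" using arg_cong[OF er, of deg] deg_e deg_E[OF ghk(1)] A.deg_mult[of g r] rA A.E_S[OF ghk(1)] by simp
    then have rE: "r \<in> A.E" using E0 rA by blast
    have "f \<odot> A.pw b k = A.pw b k"
      by (cases k) (simp_all add: A.pw_Suc_left A.assoc P.bab' P.bab_left del: A.pw.simps(2))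
    then have "f \<odot> r = r" unfolding r_def by (simp flip: A.assoc)
    then have "e = g \<odot> f \<odot> r" using er by (simp add: A.assoc)
    then show ?thesis using A.band_sandwich[OF ghk(1) fE rE] by metis
  next
    case 2
    have "f = (b \<odot> p \<odot> a) \<odot> e \<odot> (a \<odot> q \<odot> a)" using fpq by (simp add: A.assoc P.aba_left)
    moreover have "b \<odot> p \<odot> a \<in> A.E" "a \<odot> q \<odot> a \<in> A.E"
      using 2 degs pq deg_a1 deg_b1 by (auto intro!: E0 A.closed simp: A.deg_mult A.closed)
    ultimately show ?thesis using below by blast
  next
    case 3
    have "f = (b \<odot> p) \<odot> e \<odot> (a \<odot> (a \<odot> q \<odot> a))" using fpq by (simp add: A.assoc P.aba_left)
    moreover have "b \<odot> p \<in> A.E" "a \<odot> (a \<odot> q \<odot> a) \<in> A.E"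
      using 3 degs pq deg_a1 deg_b1 by (auto intro!: E0 A.closed simp: A.deg_mult A.closed)
    ultimately show ?thesis using below by blast
  next
    case 4
    have bp: "b \<odot> p \<in> A" "deg (b \<odot> p) = deg p - 1" using pq deg_b1 by (simp_all add: A.closed A.deg_mult)
    then obtain g h k where ghk: "g \<in> A.E" "h \<in> A.E" "int (Suc k) = deg p - 1" "b \<odot> p = g \<odot> A.pw a k \<odot> h"
      using factor[of "b \<odot> p"] 4 by auto
    define r where "r = A.pw a k \<odot> h \<odot> a \<odot> (a \<odot> q \<odot> a)"
    have "f = (b \<odot> p) \<odot> (a \<odot> (a \<odot> q \<odot> a))" using fpq by (simp add: A.assoc)
    also have "\<dots> = g \<odot> r" unfolding ghk(4) r_def by (simp add: A.assoc)
    finally have fr: "f = g \<odot> r" .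
    have rA: "r \<in> A" unfolding r_def using ghk pq A.E_S by (intro A.closed A.pw_S) auto
    have "deg r = 0" using arg_cong[OF fr, of deg] deg_f deg_E[OF ghk(1)] A.deg_mult[of g r] rA A.E_S[OF ghk(1)] by simp
    then have rE: "r \<in> A.E" using E0 rA by blast
    have "e \<odot> A.pw a k = A.pw a k"
      by (cases k) (simp_all add: A.pw_Suc_left A.assoc P.aba' P.aba_left del: A.pw.simps(2))
    then have "e \<odot> r = r" unfolding r_def by (simp flip: A.assoc)
    then have "f = g \<odot> e \<odot> r" using fr by (simp add: A.assoc)
    then show ?thesis using below ghk(1) rE by blast
  qed
qed

text \<open>\<open>g\<close> and \<open>x\<close> generate only \<open>g\<close> and powers of
  \<open>x\<close>, so both products are powers of \<open>\<phi> x\<close>. Multiplying by the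
  idempotent \<open>\<phi> g\<close> once more must not change them, which excludes every exponent
  above one.\<close>

lemma fixes_image:
  assumes g: "g \<in> A.E" and x: "x \<in> A" "deg x \<noteq> 0" "g \<odot> x = x" "x \<odot> g = x"
  shows "\<phi> g \<star> \<phi> x = \<phi> x" "\<phi> x \<star> \<phi> g = \<phi> x"
proof -
  have gA: "g \<in> A" using g by (rule A.E_S)
  let ?s = "\<phi> g" and ?c = "\<phi> x"
  have sE: "?s \<in> T.E" using dl_0_E[of ?s] gA deg_E[OF g] by simp
  have inf: "infinite (gen mT {?c})" using infinite_T x by simp
  have fx: "g \<odot> z = z \<and> z \<odot> g = z" if "z \<in> gen mA {x}" for z
    using that
  proof induction
    case (gen_mult y z)
    have "g \<odot> (y \<odot> z) = g \<odot> y \<odot> z" "y \<odot> z \<odot> g = y \<odot> (z \<odot> g)" by (simp_all only: A.assoc)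
    then show ?case using gen_mult by simp
  qed (use x in simp)
  have "gen mA {g, x} \<subseteq> insert g (gen mA {x})"
  proof (rule gen_minimal)
    fix y z assume "y \<in> insert g (gen mA {x})" "z \<in> insert g (gen mA {x})"
    then show "y \<odot> z \<in> insert g (gen mA {x})"
      using fx A.E_idem[OF g] by (elim insertE) (simp_all add: gen_mult)
  qed (auto intro: gen_base)
  moreover have "\<psi> (?s \<star> ?c) \<in> gen mA {g, x}" "\<psi> (?c \<star> ?s) \<in> gen mA {g, x}"
    using psi_mult[of ?s ?c] psi_mult[of ?c ?s] x gA by (simp_all add: insert_commute)
  moreover have "dl (?s \<star> ?c) \<noteq> 0 \<and> dl (?c \<star> ?s) \<noteq> 0"
  proof (cases "deg x > 0")
    case True
    then show ?thesis using E_pos[OF sE, of ?c] x by simp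
  next
    case False
    then show ?thesis using E_neg[OF sE, of ?c] x by simp
  qed
  ultimately have "\<psi> (?s \<star> ?c) \<in> gen mA {x}" "\<psi> (?c \<star> ?s) \<in> gen mA {x}"
    using deg_E[OF g] by (auto simp: dl_def)
  then have "\<phi> (\<psi> (?s \<star> ?c)) \<in> gen mT {?c}" "\<phi> (\<psi> (?c \<star> ?s)) \<in> gen mT {?c}"
    using gen_phi[of "{x}"] x by auto
  then have "?s \<star> ?c \<in> gen mT {?c}" "?c \<star> ?s \<in> gen mT {?c}" using gA x T_closed by simp_all
  then obtain i j where i: "?s \<star> ?c = T.pw ?c i" and j: "?c \<star> ?s = T.pw ?c j"
    by (auto simp: T.gen_single)
  have "i = 0"
  proof (cases i)
    case (Suc k)
    have "?s \<star> T.pw ?c i = T.pw ?c i" using T.E_idem_left[OF sE, of ?c] unfolding i .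
    moreover have "?s \<star> T.pw ?c i = ?s \<star> ?c \<star> T.pw ?c k"
      unfolding Suc T.pw_Suc_left by (rule T.assoc[symmetric])
    moreover have "?s \<star> ?c \<star> T.pw ?c k = T.pw ?c (Suc (i + k))" unfolding i by (rule T.pw_add)
    ultimately have "T.pw ?c i = T.pw ?c (Suc (i + k))" by metis
    then show ?thesis unfolding T.pw_inj_infinite[OF inf] by simp
  qed
  then show "?s \<star> ?c = ?c" using i by simp
  have "j = 0"
  proof (cases j)
    case (Suc k)
    have "?c \<star> ?s \<star> ?s = ?c \<star> ?s" unfolding T.assoc T.E_idem[OF sE] ..
    then have "T.pw ?c j \<star> ?s = T.pw ?c j" unfolding j .
    moreover have "T.pw ?c j \<star> ?s = T.pw ?c k \<star> (?c \<star> ?s)"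
      unfolding Suc T.pw.simps(2) by (rule T.assoc)
    moreover have "T.pw ?c k \<star> (?c \<star> ?s) = T.pw ?c (Suc (k + j))" unfolding j by (rule T.pw_add)
    ultimately have "T.pw ?c j = T.pw ?c (Suc (k + j))" by metis
    then show ?thesis unfolding T.pw_inj_infinite[OF inf] by simp
  qed
  then show "?c \<star> ?s = ?c" using j by simp
qed

text \<open>Here \<open>a\<^sub>1 = fa\<close> and \<open>b\<^sub>1 = bf\<close> generate a monoid with identity \<open>f = b\<^sub>1 a\<^sub>1\<close>, and \<open>A\<close> is generated by
  \<open>a\<^sub>1\<close>, \<open>b\<^sub>1\<close> and \<open>e\<close>; the images of these three are regular, hence so is all of \<open>T\<close>.\<close>

lemma comparable_inverse:
  assumes efe: "e \<odot> f \<odot> e = e"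
  shows "\<phi> a \<star> \<phi> b \<star> \<phi> a = \<phi> a \<and> \<phi> b \<star> \<phi> a \<star> \<phi> b = \<phi> b"
proof -
  define a1 where "a1 = f \<odot> a"
  define b1 where "b1 = b \<odot> f"
  have ff: "f \<odot> f = f" and ee: "e \<odot> e = e" using A.E_idem by auto
  have A1: "a1 \<in> A" "b1 \<in> A" by (simp_all add: a1_def b1_def A.closed)
  have b1a1: "b1 \<odot> a1 = f"
  proof -
    have "b \<odot> (e \<odot> f \<odot> e) \<odot> a = b \<odot> (f \<odot> a)" by (simp add: A.assoc P.bab_left P.aba')
    then have "b \<odot> (f \<odot> a) = b \<odot> e \<odot> a" unfolding efe by simp
    also have "\<dots> = f" by (simp add: A.assoc P.aba')
    finally have "b \<odot> (f \<odot> a) = f" .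
    moreover have "b1 \<odot> a1 = b \<odot> (f \<odot> f) \<odot> a" by (simp add: a1_def b1_def A.assoc)
    ultimately show ?thesis unfolding ff by (simp add: A.assoc)
  qed
  have fix1: "f \<odot> a1 = a1" "a1 \<odot> f = a1" "f \<odot> b1 = b1" "b1 \<odot> f = b1"
    unfolding a1_def b1_def by (simp_all add: A.assoc P.aba' P.bab' P.aba_left P.bab_left)
  have pair: "inverse_pair mA A a1 b1"
    by unfold_locales (use A1 b1a1 fix1 in \<open>simp_all add: A.assoc\<close>)
  have d1: "deg a1 = 1" "deg b1 = -1"
    using deg_a1 deg_b1 by (simp_all add: a1_def b1_def A.deg_mult A.closed)
  have ab: "a = e \<odot> a1" "b = b1 \<odot> e"
  proof -
    have "e \<odot> f \<odot> e \<odot> a = a" "b \<odot> (e \<odot> f \<odot> e) = b" unfolding efe by (simp_all add: A.assoc P.aba' P.bab')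
    then show "a = e \<odot> a1" "b = b1 \<odot> e" by (simp_all add: a1_def b1_def A.assoc P.aba' P.bab_left)
  qed
  let ?c = "\<phi> a1" and ?d = "\<phi> b1" and ?s = "\<phi> f"
  have T1: "?c \<in> T" "?d \<in> T" using A1 by simp_all
  note cdE = pair_products_idempotent[OF pair d1]
  have sc: "?s \<star> ?c = ?c" "?c \<star> ?s = ?c" "?s \<star> ?d = ?d" "?d \<star> ?s = ?d"
    using fixes_image[OF P.ba_E, of a1] fixes_image[OF P.ba_E, of b1] A1 d1 fix1 by auto
  have "f \<in> gen mA {a1, b1}" unfolding b1a1[symmetric] by (auto intro: gen_mult gen_base)
  then have "?s \<in> gen mT {?c, ?d}" using gen_phi[of "{a1, b1}" f] A1 by simp
  moreover have "?s \<notin> {?c, ?d}" using d1 deg_f A1 f_A by (auto dest: arg_cong[where f = dl])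
  ultimately have "\<exists>z\<in>gen mT {?c, ?d}. ?s = ?c \<star> z \<or> ?s = ?d \<star> z"
    by (cases rule: T.gen_left_cases) blast+
  then obtain z where z: "z \<in> gen mT {?c, ?d}" "?s = ?c \<star> z \<or> ?s = ?d \<star> z" by blast
  have zT: "z \<in> T" using z gen_T[of "{?c, ?d}"] T1 by auto
  have reg: "(\<exists>c'\<in>T. ?c \<star> c' \<star> ?c = ?c) \<and> (\<exists>d'\<in>T. ?d \<star> d' \<star> ?d = ?d)"
    using z(2)
  proof
    \<comment> \<open>\<open>?s\<close> is an identity for \<open>?c\<close> and \<open>?d\<close>.
      So \<open>z\<close> makes \<open>?c\<close> regular, and
      \<open>?d = ?d \<star> ?c \<star> z\<close> is fixed by the idempotent
      \<open>?d \<star> ?c\<close>.\<close>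
    assume s: "?s = ?c \<star> z"
    then have "?c \<star> z \<star> ?c = ?c" using sc by simp
    moreover have "?d = ?d \<star> ?c \<star> z" using s sc by (simp add: T.assoc)
    then have "?d \<star> ?c \<star> ?d = ?d \<star> ?c \<star> (?d \<star> ?c \<star> z)" by simp
    then have "?d \<star> ?c \<star> ?d = (?d \<star> ?c \<star> (?d \<star> ?c)) \<star> z" by (simp add: T.assoc)
    then have "?d \<star> ?c \<star> ?d = ?d" unfolding T.E_idem[OF cdE(2)] using \<open>?d = ?d \<star> ?c \<star> z\<close> by simp
    ultimately show ?thesis using zT T1 by blast
  next
    assume s: "?s = ?d \<star> z"
    then have "?d \<star> z \<star> ?d = ?d" using sc by simp
    moreover have "?c = ?c \<star> ?d \<star> z" using s sc by (simp add: T.assoc)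
    then have "?c \<star> ?d \<star> ?c = ?c \<star> ?d \<star> (?c \<star> ?d \<star> z)" by simp
    then have "?c \<star> ?d \<star> ?c = (?c \<star> ?d \<star> (?c \<star> ?d)) \<star> z" by (simp add: T.assoc)
    then have "?c \<star> ?d \<star> ?c = ?c" unfolding T.E_idem[OF cdE(1)] using \<open>?c = ?c \<star> ?d \<star> z\<close> by simp
    ultimately show ?thesis using zT T1 by blast
  qed
  have eT: "\<phi> e \<in> T" "\<phi> e \<star> \<phi> e = \<phi> e" using dl_0[of "\<phi> e"] deg_e e_A by simp_all
  have regular: "\<exists>t'\<in>T. t \<star> t' \<star> t = t" if "t \<in> T" for t
  proof -
    have "gen mA {a, b} \<subseteq> gen mA {a1, b1, e}"
    proof (rule gen_mono)
      have "e \<odot> a1 \<in> gen mA {a1, b1, e}" "b1 \<odot> e \<in> gen mA {a1, b1, e}"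
        by (rule gen_mult; rule gen_base; simp)+
      then show "{a, b} \<subseteq> gen mA {a1, b1, e}" using ab by simp
    qed
    moreover have "gen mA {a1, b1, e} \<subseteq> A" using A1 e_A by (intro A.gen_S) auto
    ultimately have "gen mA {a1, b1, e} = A" using gen_ab by simp
    then have "gen mT {?c, ?d, \<phi> e} = T" using gen_image[of "{a1, b1, e}"] A1 e_A bij by (simp add: bij_betw_def)
    moreover have "\<exists>t'\<in>T. t \<star> t' \<star> t = t" if "t \<in> {?c, ?d, \<phi> e}" for t
      using that reg eT by (metis insertE singletonD)
    ultimately show ?thesis using T.regular_gen[of "{?c, ?d, \<phi> e}" t] T1 eT that by auto
  qed
  interpret f: orthodox_iso mA A "\<lambda>x. - deg x" mT T \<phi> b a by (rule flip_orthodox)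
  have "\<phi> a \<star> \<phi> b \<star> \<phi> a = \<phi> a" using regular_imp_inverse[OF ab_T_E] regular[of "\<phi> a"] by auto
  moreover have "\<phi> b \<star> \<phi> a \<star> \<phi> b = \<phi> b" using f.regular_imp_inverse[OF f.ab_T_E] regular[of "\<phi> b"] by auto
  ultimately show ?thesis ..
qed

theorem image_inverse: "\<phi> a \<star> \<phi> b \<star> \<phi> a = \<phi> a \<and> \<phi> b \<star> \<phi> a \<star> \<phi> b = \<phi> b"
proof -
  interpret f: orthodox_iso mA A "\<lambda>x. - deg x" mT T \<phi> b a by (rule flip_orthodox)
  show ?thesis
  proof (cases "e \<in> I")
    case True
    \<comment> \<open>The second alternative of \<open>in_I_comparable\<close> is the first one for
      the swapped generators.\<close>
    then show ?thesis using in_I_comparable comparable_inverse f.comparable_inverse by blast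
  next
    case False
    \<comment> \<open>For the swapped generators the ideal is that of
      \<open>b \<odot> b\<close>.\<close>
    have sub: "f.I \<subseteq> I"
      unfolding f.I_def using I_left I_right bb_I by auto
    have fI: "f \<notin> I" "f \<notin> f.I" using False e_I_iff sub by auto
    have ef: "\<phi> e \<noteq> \<phi> f"
    proof
      assume "\<phi> e = \<phi> f"
      then have "e = f" using e_A f_A by (metis psi_phi)
      then have "a = f \<odot> a" using aba by simp
      then have "a \<in> I" using I_left[OF b_A aa_I] by (simp add: A.assoc)
      then show False using False e_I_iff by simp
    qed
    have "\<phi> e \<in> {\<phi> a \<star> \<phi> b, \<phi> b \<star> \<phi> a}" using image_e[OF False] .
    moreover have "\<phi> f \<in> {\<phi> b \<star> \<phi> a, \<phi> a \<star> \<phi> b}" using f.image_e[OF fI(2)] .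
    ultimately have "\<phi> a \<star> \<phi> b \<in> {\<phi> e, \<phi> f}" "\<phi> b \<star> \<phi> a \<in> {\<phi> f, \<phi> e}" using ef by auto
    then show ?thesis using not_in_I_inverse[OF False] f.not_in_I_inverse[OF fI(2)] by blast
  qed
qed

end

section \<open>From lattice isomorphisms to bijections\<close>

definition subs :: "('a \<Rightarrow> 'a \<Rightarrow> 'a) \<Rightarrow> 'a set \<Rightarrow> 'a set set" where
  "subs m S = {H. H \<subseteq> S \<and> (\<forall>x\<in>H. \<forall>y\<in>H. m x y \<in> H)}"

lemma subs_gen: "H \<in> subs m S \<Longrightarrow> X \<subseteq> H \<Longrightarrow> gen m X \<subseteq> H"
  by (rule gen_minimal) (auto simp: subs_def)

locale sub_lattice_iso = A: graded mA A deg + T: assoc_op mT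
  for mA :: "'a \<Rightarrow> 'a \<Rightarrow> 'a" (infixl "\<odot>" 70) and A :: "'a set" and deg :: "'a \<Rightarrow> int"
    and mT :: "'b \<Rightarrow> 'b \<Rightarrow> 'b" (infixl "\<star>" 70) +
  fixes T :: "'b set" and F :: "'a set \<Rightarrow> 'b set"
  assumes T_closed: "s \<in> T \<Longrightarrow> t \<in> T \<Longrightarrow> s \<star> t \<in> T"
    and bij_F: "bij_betw F (subs mA A) (subs mT T)"
    and F_mono: "X \<in> subs mA A \<Longrightarrow> Y \<in> subs mA A \<Longrightarrow> X \<subseteq> Y \<longleftrightarrow> F X \<subseteq> F Y"
begin

lemma gen_subs_A: "X \<subseteq> A \<Longrightarrow> gen mA X \<in> subs mA A"
  using A.gen_S by (auto simp: subs_def intro: gen_mult)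

lemma gen_subs_T: "X \<subseteq> T \<Longrightarrow> gen mT X \<in> subs mT T"
proof -
  assume "X \<subseteq> T"
  then have "gen mT X \<subseteq> T" by (intro gen_minimal T_closed) auto
  then show ?thesis by (auto simp: subs_def intro: gen_mult)
qed

lemma F_subs: "H \<in> subs mA A \<Longrightarrow> F H \<in> subs mT T"
  using bij_F by (auto simp: bij_betw_def)

lemma F_onto:
  assumes "K \<in> subs mT T" shows "\<exists>H\<in>subs mA A. F H = K"
proof -
  from assms have "K \<in> F ` subs mA A" unfolding bij_betw_imp_surj_on[OF bij_F] .
  then obtain H where "H \<in> subs mA A" "K = F H" by (rule imageE)
  then show ?thesis by (intro bexI[of _ H]) simp_all
qed

lemma F_inj: "X \<in> subs mA A \<Longrightarrow> Y \<in> subs mA A \<Longrightarrow> F X = F Y \<Longrightarrow> X = Y"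
  using bij_F by (auto simp: bij_betw_def inj_on_def)

text \<open>\<open>gen {x} - {x}\<close> is the greatest proper subsemigroup of \<open>gen {x}\<close>; it is empty if \<open>x\<close> is idempotent.\<close>

lemma max_subs:
  assumes x: "x \<in> A" shows "gen mA {x} - {x} \<in> subs mA A"
proof -
  have "y \<odot> z \<noteq> x" if y: "y \<in> gen mA {x}" "y \<noteq> x" and z: "z \<in> gen mA {x}" for y z
  proof
    assume eq: "y \<odot> z = x"
    show False
    proof (cases "deg x = 0")
      case True
      then have "gen mA {x} = {x}" using A.deg_0 x A.gen_single_idem by blast
      then show False using y by simp
    next
      case False
      obtain i where "y = A.pw x i" "deg y = int (Suc i) * deg x" by (rule A.gen_single_deg[OF x y(1)])
      moreover obtain j where "z = A.pw x j" "deg z = int (Suc j) * deg x" by (rule A.gen_single_deg[OF x z])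
      ultimately have "deg (y \<odot> z) = (int (Suc i) + int (Suc j)) * deg x"
        using A.deg_mult[of y z] A.pw_S[OF x] by (simp add: algebra_simps)
      then have "int (Suc i) + int (Suc j) = 1" using eq False by simp
      then show False by simp
    qed
  qed
  moreover have "gen mA {x} \<subseteq> A" using x by (intro A.gen_S) auto
  ultimately show ?thesis by (auto simp: subs_def intro: gen_mult)
qed

lemma proper_subs:
  assumes "x \<in> A" "H \<in> subs mA A" "H \<subseteq> gen mA {x}" "H \<noteq> gen mA {x}"
  shows "H \<subseteq> gen mA {x} - {x}"
proof -
  have "x \<notin> H" using assms subs_gen[of H mA A "{x}"] by blast
  then show ?thesis using assms by blast
qed

lemma gen_single_inj_A:
  assumes "x \<in> A" "x' \<in> A" "gen mA {x} = gen mA {x'}" shows "x = x'"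
proof (rule ccontr)
  assume "x \<noteq> x'"
  then have "{x'} \<subseteq> gen mA {x} - {x}" using assms(3) gen_base[of x' "{x'}" mA] by auto
  then have "gen mA {x'} \<subseteq> gen mA {x} - {x}" by (rule subs_gen[OF max_subs[OF assms(1)]])
  then show False using assms(3) gen_base[of x "{x}" mA] by blast
qed

text \<open>Any element of \<open>F ?G\<close> outside the image of the greatest proper subsemigroup
  \<open>?M\<close> generates \<open>F ?G\<close>.\<close>

lemma image_monogenic:
  assumes x: "x \<in> A" shows "\<exists>y\<in>T. gen mT {y} = F (gen mA {x})"
proof -
  let ?G = "gen mA {x}" and ?M = "gen mA {x} - {x}"
  have G: "?G \<in> subs mA A" using x by (intro gen_subs_A) auto
  have M: "?M \<in> subs mA A" by (rule max_subs[OF x])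
  have "x \<in> ?G" by (auto intro: gen_base)
  then have "\<not> F ?G \<subseteq> F ?M" using F_mono[OF G M] by blast
  then obtain y where y: "y \<in> F ?G" "y \<notin> F ?M" by blast
  have yT: "y \<in> T" using F_subs[OF G] y by (auto simp: subs_def)
  obtain H where H: "H \<in> subs mA A" "F H = gen mT {y}" using F_onto[OF gen_subs_T[of "{y}"]] yT by auto
  have "F H \<subseteq> F ?G" unfolding H(2) using y by (intro subs_gen[OF F_subs[OF G]]) auto
  then have HG: "H \<subseteq> ?G" using F_mono[OF H(1) G] by blast
  have "H = ?G"
  proof (rule ccontr)
    assume "H \<noteq> ?G"
    then have "H \<subseteq> ?M" by (rule proper_subs[OF x H(1) HG])
    then have "F H \<subseteq> F ?M" using F_mono[OF H(1) M] by blast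
    then show False using y H(2) gen_base[of y "{y}" mT] by blast
  qed
  then show ?thesis using H yT by blast
qed

text \<open>If \<open>gen mT {y} - {y}\<close> is a subsemigroup, the argument of
  \<open>image_monogenic\<close> runs backwards. If not, \<open>y\<close> generates a finite group;
  its identity lies in every nonempty subsemigroup, and in \<open>A\<close> that is possible only
  for a single idempotent, so the group is trivial.\<close>

lemma monogenic_image:
  assumes y: "y \<in> T"
  shows "\<exists>x\<in>A. F (gen mA {x}) = gen mT {y} \<and> (\<forall>y'. gen mT {y'} = gen mT {y} \<longrightarrow> y' = y)"
proof -
  have gy: "gen mT {y} \<in> subs mT T" using y by (intro gen_subs_T) auto
  have y_in: "z \<in> gen mT {z}" for z by (auto intro: gen_base)
  obtain H where H: "H \<in> subs mA A" "F H = gen mT {y}" using F_onto[OF gy] by blast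
  have genH: "gen mA {x} \<in> subs mA A \<and> gen mA {x} \<subseteq> H \<and> x \<in> A" if "x \<in> H" for x
    using subs_gen[OF H(1), of "{x}"] that H(1) gen_subs_A[of "{x}"] by (auto simp: subs_def)
  show ?thesis
  proof (cases "gen mT {y} - {y} \<in> subs mT T")
    case True
    then obtain M where M: "M \<in> subs mA A" "F M = gen mT {y} - {y}" using F_onto by blast
    have "\<not> H \<subseteq> M" using F_mono[OF H(1) M(1)] M(2) H(2) y_in[of y] by blast
    then obtain x where x: "x \<in> H" "x \<notin> M" by blast
    have "\<not> gen mA {x} \<subseteq> M" using x gen_base[of x "{x}" mA] by blast
    then have "\<not> F (gen mA {x}) \<subseteq> gen mT {y} - {y}" using F_mono[of "gen mA {x}" M] genH[OF x(1)] M by blast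
    moreover have sub: "F (gen mA {x}) \<subseteq> gen mT {y}" using F_mono[of "gen mA {x}" H] genH[OF x(1)] H by blast
    ultimately have "{y} \<subseteq> F (gen mA {x})" by blast
    then have "gen mT {y} \<subseteq> F (gen mA {x})" using subs_gen[OF F_subs] genH[OF x(1)] by blast
    then have "F (gen mA {x}) = gen mT {y}" using sub by blast
    moreover have "y' = y" if eq: "gen mT {y'} = gen mT {y}" for y'
    proof (rule ccontr)
      assume "y' \<noteq> y"
      then have "{y'} \<subseteq> gen mT {y} - {y}" using y_in[of y'] eq by auto
      then have "gen mT {y'} \<subseteq> gen mT {y} - {y}" by (rule subs_gen[OF True])
      then show False using eq y_in[of y] by blast
    qed
    ultimately show ?thesis using genH[OF x(1)] by blast
  next
    case False
    then have "\<exists>u\<in>gen mT {y}. \<exists>v\<in>gen mT {y}. u \<star> v = y"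
      using gy by (auto simp: subs_def)
    then obtain i j where "T.pw y i \<star> T.pw y j = y" by (auto simp: T.gen_single)
    then obtain k where k: "T.pw y k \<star> y = y" by (auto simp: T.pw_add)
    \<comment> \<open>The identity of the group generated by \<open>y\<close>.\<close>
    define w where "w = T.pw y k"
    have w_left: "w \<star> T.pw y n = T.pw y n" for n
    proof (cases n)
      case (Suc l)
      have "w \<star> (y \<star> T.pw y l) = w \<star> y \<star> T.pw y l" by (rule T.assoc[symmetric])
      also have "\<dots> = y \<star> T.pw y l" using k by (simp add: w_def)
      finally show ?thesis unfolding Suc T.pw_Suc_left .
    qed (use k in \<open>simp add: w_def\<close>)
    have ww: "w \<star> w = w" using w_left[of k] by (simp add: w_def)
    have gen_w: "gen mT {w} = {w}" using ww by (rule T.gen_single_idem)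
    have w_gen: "w \<in> gen mT {z}" if z: "z \<in> gen mT {y}" for z
    proof -
      obtain n where n: "z = T.pw y n" using z by (auto simp: T.gen_single)
      have "T.pw z k = T.pw w n" unfolding n w_def T.pw_pw by (simp add: algebra_simps)
      also have "\<dots> = w" using gen_w by (auto simp: T.gen_single)
      finally show ?thesis by (metis T.pw_in_gen y_in)
    qed
    have wT: "w \<in> T" using w_gen[OF y_in] gy by (auto simp: subs_def)
    obtain W where W: "W \<in> subs mA A" "F W = {w}" using F_onto[OF gen_subs_T[of "{w}"]] wT gen_w by auto
    have W_gen: "W \<subseteq> gen mA {q}" if q: "q \<in> H" for q
    proof -
      obtain z where z: "z \<in> T" "gen mT {z} = F (gen mA {q})" using image_monogenic genH[OF q] by blast
      have "F (gen mA {q}) \<subseteq> gen mT {y}" using F_mono[of "gen mA {q}" H] genH[OF q] H by blast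
      then have "z \<in> gen mT {y}" using z y_in[of z] by blast
      then have "w \<in> gen mT {z}" by (rule w_gen)
      then have "F W \<subseteq> F (gen mA {q})" unfolding W(2) z(2)[symmetric] by simp
      then show ?thesis using F_mono[OF W(1)] genH[OF q] by blast
    qed
    have "W \<noteq> {}"
    proof
      assume "W = {}"
      moreover obtain K where "K \<in> subs mA A" "F K = {}" using F_onto[of "{}"] by (auto simp: subs_def)
      ultimately have "F W \<subseteq> {}" using F_mono[OF W(1), of K] by auto
      then show False using W by simp
    qed
    moreover have "W \<subseteq> H" using F_mono[OF W(1) H(1)] W(2) H(2) w_gen[OF y_in[of y]] by simp
    ultimately obtain q0 where q0: "q0 \<in> W" "q0 \<in> H" by blast
    have q0A: "q0 \<in> A" using genH q0 by blast
    \<comment> \<open>\<open>W\<close> lies in the subsemigroup generated by the square of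
      \<open>q0\<close>, so \<open>q0\<close> is a power of its own square.\<close>
    have "deg q0 = 0"
    proof -
      have "q0 \<odot> q0 \<in> H" using H(1) q0 by (auto simp: subs_def)
      then have "q0 \<in> gen mA {q0 \<odot> q0}" using W_gen q0 by blast
      then obtain l where "deg q0 = int (Suc l) * deg (q0 \<odot> q0)"
        using A.gen_single_deg[of "q0 \<odot> q0" q0] A.closed q0A by blast
      then have "deg q0 * (2 * int l + 1) = 0" using A.deg_mult[OF q0A q0A] by (simp add: algebra_simps)
      moreover have "2 * int l + 1 \<noteq> 0" by linarith
      ultimately show ?thesis by simp
    qed
    have "q = q0" if q: "q \<in> H" for q
    proof -
      have "q0 \<in> gen mA {q}" using W_gen[OF q] q0 by blast
      then obtain l where "deg q0 = int (Suc l) * deg q" using A.gen_single_deg genH[OF q] by blast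
      then have "deg q = 0" using \<open>deg q0 = 0\<close> by simp
      then have "gen mA {q} = {q}" using A.deg_0 genH[OF q] A.gen_single_idem by blast
      then show ?thesis using \<open>q0 \<in> gen mA {q}\<close> by simp
    qed
    then have "H = {q0}" "W = {q0}" using q0 \<open>W \<subseteq> H\<close> by blast+
    then have gyw: "gen mT {y} = {w}" using H W by simp
    have "F (gen mA {q0}) = gen mT {y}"
      using \<open>deg q0 = 0\<close> A.deg_0[OF q0A] A.gen_single_idem \<open>H = {q0}\<close> H(2) by simp
    moreover have "y' = y" if "gen mT {y'} = gen mT {y}" for y'
      using y_in[of y'] y_in[of y] that gyw by simp
    ultimately show ?thesis using q0A by blast
  qed
qed

text \<open>\<open>\<phi> x\<close> is the generator of \<open>F (gen mA {x})\<close>, unique by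
  \<open>monogenic_image\<close>. A subsemigroup is determined by the monogenic ones inside it, so
  \<open>F\<close> is the direct image under \<open>\<phi>\<close>.\<close>

theorem induced_bijection:
  obtains \<phi> where "bij_betw \<phi> A T" "\<And>X. X \<subseteq> A \<Longrightarrow> gen mT (\<phi> ` X) = \<phi> ` gen mA X"
proof -
  define \<phi> where "\<phi> x = (SOME y. y \<in> T \<and> gen mT {y} = F (gen mA {x}))" for x
  have \<phi>: "\<phi> x \<in> T \<and> gen mT {\<phi> x} = F (gen mA {x})" if "x \<in> A" for x
    unfolding \<phi>_def using image_monogenic[OF that] by (metis (mono_tags, lifting) someI_ex)
  have single: "gen mA {x} \<in> subs mA A" if "x \<in> A" for x using gen_subs_A[of "{x}"] that by simp
  have inj: "inj_on \<phi> A"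
  proof (rule inj_onI)
    fix x x' assume x: "x \<in> A" "x' \<in> A" "\<phi> x = \<phi> x'"
    then have "F (gen mA {x}) = F (gen mA {x'})" using \<phi> by metis
    then have "gen mA {x} = gen mA {x'}" by (rule F_inj[OF single[OF x(1)] single[OF x(2)]])
    then show "x = x'" by (rule gen_single_inj_A[OF x(1,2)])
  qed
  have onto: "\<exists>x\<in>A. y = \<phi> x \<and> F (gen mA {x}) = gen mT {y}" if y: "y \<in> T" for y
    using monogenic_image[OF y] \<phi> by metis
  have bij: "bij_betw \<phi> A T" unfolding bij_betw_def using inj \<phi> onto by blast
  have image: "\<phi> ` X = F X" if X: "X \<in> subs mA A" for X
  proof
    show "\<phi> ` X \<subseteq> F X"
    proof
      fix y assume "y \<in> \<phi> ` X"
      then obtain x where x: "x \<in> X" "y = \<phi> x" by blast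
      then have xA: "x \<in> A" using X by (auto simp: subs_def)
      have "gen mA {x} \<subseteq> X" using subs_gen[OF X, of "{x}"] x by simp
      then have "F (gen mA {x}) \<subseteq> F X" using F_mono[OF single[OF xA] X] by blast
      then show "y \<in> F X" using \<phi>[OF xA] x gen_base[of y "{y}" mT] by blast
    qed
    show "F X \<subseteq> \<phi> ` X"
    proof
      fix y assume y: "y \<in> F X"
      then have "y \<in> T" using F_subs[OF X] by (auto simp: subs_def)
      then obtain x where x: "x \<in> A" "y = \<phi> x" "F (gen mA {x}) = gen mT {y}" using onto by blast
      have "F (gen mA {x}) \<subseteq> F X" unfolding x(3) using subs_gen[OF F_subs[OF X], of "{y}"] y by simp
      then have "gen mA {x} \<subseteq> X" using F_mono[OF single[OF x(1)] X] by blast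
      then show "y \<in> \<phi> ` X" using x gen_base[of x "{x}" mA] by blast
    qed
  qed
  have "gen mT (\<phi> ` X) = \<phi> ` gen mA X" if X: "X \<subseteq> A" for X
  proof
    have XT: "\<phi> ` X \<subseteq> T" using X \<phi> by auto
    have G: "gen mA X \<in> subs mA A" using X by (rule gen_subs_A)
    have "X \<subseteq> gen mA X" by (auto intro: gen_base)
    then show "gen mT (\<phi> ` X) \<subseteq> \<phi> ` gen mA X"
      unfolding image[OF G] by (intro subs_gen[OF F_subs[OF G]]) (auto simp flip: image[OF G])
    obtain H where H: "H \<in> subs mA A" "F H = gen mT (\<phi> ` X)" using F_onto[OF gen_subs_T[OF XT]] by blast
    have "X \<subseteq> H"
    proof
      fix x assume x: "x \<in> X"
      then have "\<phi> x \<in> \<phi> ` H" unfolding image[OF H(1)] H(2) by (auto intro: gen_base)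
      then show "x \<in> H" using inj x X H(1) by (auto simp: subs_def inj_on_def)
    qed
    then have "gen mA X \<subseteq> H" by (rule subs_gen[OF H(1)])
    then show "\<phi> ` gen mA X \<subseteq> gen mT (\<phi> ` X)" using image[OF H(1)] H(2) by blast
  qed
  then show thesis using bij that by blast
qed

end

section \<open>Transfer to semigroups with a carrier\<close>

text \<open>The operation of a semigroup, made associative on the whole type: off the carrier its value is
  an element outside the carrier, which exists whenever it is needed.\<close>

definition total_op :: "'a magma \<Rightarrow> 'a \<Rightarrow> 'a \<Rightarrow> 'a" where
  "total_op S x y = (if x \<in> carrier S \<and> y \<in> carrier S then x \<cdot>\<^bsub>S\<^esub> y else SOME z. z \<notin> carrier S)"

lemma total_op_eq: "x \<in> carrier S \<Longrightarrow> y \<in> carrier S \<Longrightarrow> total_op S x y = x \<cdot>\<^bsub>S\<^esub> y"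
  by (simp add: total_op_def)

lemma total_op_out:
  assumes "x \<notin> carrier S \<or> y \<notin> carrier S"
  shows "total_op S x y = (SOME z. z \<notin> carrier S)" "total_op S x y \<notin> carrier S"
  using assms someI_ex[of "\<lambda>z. z \<notin> carrier S"] by (auto simp: total_op_def)

lemma subs_total_op: "subs (total_op S) (carrier S) = Sub S"
  by (auto simp: subs_def Sub_def subsemigroup_def total_op_eq subset_iff)

context carrier_semigroup
begin

lemma total_op_closed: "x \<in> carrier S \<Longrightarrow> y \<in> carrier S \<Longrightarrow> total_op S x y \<in> carrier S"
  by (simp add: total_op_eq closed)

lemma assoc_total_op: "assoc_op (total_op S)"
proof
  fix x y z
  show "total_op S (total_op S x y) z = total_op S x (total_op S y z)"
  proof (cases "x \<in> carrier S \<and> y \<in> carrier S \<and> z \<in> carrier S")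
    case True
    then show ?thesis by (simp add: total_op_eq closed assoc)
  next
    case False
    then have "total_op S x y \<notin> carrier S \<or> z \<notin> carrier S" "x \<notin> carrier S \<or> total_op S y z \<notin> carrier S"
      using total_op_out(2)[of x S y] total_op_out(2)[of y S z] by blast+
    then show ?thesis using total_op_out(1) by metis
  qed
qed

lemma gen_total_op:
  assumes "X \<subseteq> carrier S" shows "gen (total_op S) X = generated S X"
proof
  have G: "gen (total_op S) X \<subseteq> carrier S" by (rule gen_minimal[OF assms total_op_closed])
  then have "total_op S x y = x \<cdot> y" if "x \<in> gen (total_op S) X" "y \<in> gen (total_op S) X" for x y
    using that by (intro total_op_eq) auto
  then have "subsemigroup S (gen (total_op S) X)"
    using G gen_mult[where m = "total_op S"] unfolding subsemigroup_def by metis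
  then show "generated S X \<subseteq> gen (total_op S) X"
    unfolding generated_def by (intro hull_minimal) (auto intro: gen_base)
  show "gen (total_op S) X \<subseteq> generated S X"
    unfolding generated_def hull_def
  proof (intro Inter_greatest)
    fix H assume "H \<in> {t. subsemigroup S t \<and> X \<subseteq> t}"
    then show "gen (total_op S) X \<subseteq> H"
      by (intro gen_minimal) (auto simp: subsemigroup_def total_op_eq subset_iff)
  qed
qed

lemma spow_total_op:
  assumes "x \<in> carrier S" shows "spow S x (Suc n) = assoc_op.pw (total_op S) x n"
proof -
  interpret t: assoc_op "total_op S" by (rule assoc_total_op)
  have "spow S x (Suc n) = t.pw x n \<and> t.pw x n \<in> carrier S"
  proof (induction n)
    case (Suc n)
    then show ?case using assms by (simp add: spow_def total_op_eq closed)
  qed (simp add: spow_def assms)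
  then show ?thesis ..
qed

lemma infinite_order_gen:
  assumes "x \<in> carrier S" shows "infinite_order S x \<longleftrightarrow> infinite (gen (total_op S) {x})"
proof -
  interpret t: assoc_op "total_op S" by (rule assoc_total_op)
  have "{spow S x n | n. n \<ge> 1} = range (t.pw x)"
  proof -
    have "{spow S x n | n. n \<ge> 1} = {spow S x (Suc n) | n. True}"
      by (auto, metis Suc_le_D) 
    then show ?thesis by (auto simp: spow_total_op[OF assms])
  qed
  then show ?thesis by (simp add: infinite_order_def t.gen_single)
qed

lemma idempotent_total_op: "x \<in> carrier S \<Longrightarrow> idempotent S x \<longleftrightarrow> total_op S x x = x"
  by (simp add: idempotent_def total_op_eq)

lemma mutually_inverse_total_op:
  "x \<in> carrier S \<Longrightarrow> y \<in> carrier S \<Longrightarrow> mutually_inverse S x y \<longleftrightarrow>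
    total_op S (total_op S x y) x = x \<and> total_op S (total_op S y x) y = y"
  by (simp add: mutually_inverse_def total_op_eq closed)

end

lemma monogenic_orthodox_isomorphic:
  assumes A: "monogenic_orthodox_with A a b" and inf: "infinite_order A a"
  shows "infinite_order A b" and "torsion_free A"
    and "carrier_semigroup T \<Longrightarrow> lattice_isomorphic A T \<Longrightarrow>
      torsion_free T \<and> (\<exists>c d. monogenic_orthodox_with T c d \<and> infinite_order T c \<and> infinite_order T d)"
proof -
  have orth: "orthodox_semigroup A" and mi: "mutually_inverse A a b" and gen: "generated A {a, b} = carrier A"
    using A by (auto simp: monogenic_orthodox_with_def)
  interpret cA: carrier_semigroup A
    using orth by (auto simp: orthodox_semigroup_def regular_semigroup_def)
  interpret assoc_op "total_op A" by (rule cA.assoc_total_op)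
  have ab: "a \<in> carrier A" "b \<in> carrier A" using mi by (auto simp: mutually_inverse_def)
  have sub: "subsemigroup A {e. idempotent A e}" using orth by (simp add: orthodox_semigroup_def)
  have E: "total_op A (total_op A e f) (total_op A e f) = total_op A e f"
    if "e \<in> carrier A" "f \<in> carrier A" "total_op A e e = e" "total_op A f f = f" for e f
  proof -
    have "idempotent A e" "idempotent A f" using that cA.idempotent_total_op by auto
    then have "idempotent A (e \<cdot>\<^bsub>A\<^esub> f)" using sub by (auto simp: subsemigroup_def)
    then show ?thesis using that cA.idempotent_total_op cA.closed by (metis total_op_eq)
  qed
  interpret M: monogenic "total_op A" "carrier A" a b
  proof
    show "total_op A (total_op A a b) a = a" "total_op A (total_op A b a) b = b"
      using mi cA.mutually_inverse_total_op ab by auto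
    show "gen (total_op A) {a, b} = carrier A" using cA.gen_total_op[of "{a, b}"] gen ab by simp
    show "infinite (gen (total_op A) {a})" using inf cA.infinite_order_gen ab by blast
  qed (use ab E cA.total_op_closed in auto)
  interpret G: graded "total_op A" "carrier A" M.deg
    by unfold_locales (simp_all add: M.deg_mult M.deg_0_iff)
  show "infinite_order A b" using M.infinite_b[OF M.infinite_a] cA.infinite_order_gen ab by blast
  show "torsion_free A"
    unfolding torsion_free_def using G.infinite_order G.deg_0 cA.infinite_order_gen cA.idempotent_total_op by metis
  assume T: "carrier_semigroup T" and iso: "lattice_isomorphic A T"
  interpret cT: carrier_semigroup T by (rule T)
  interpret tT: assoc_op "total_op T" by (rule cT.assoc_total_op)
  obtain F where F: "bij_betw F (Sub A) (Sub T)" "\<forall>X\<in>Sub A. \<forall>Y\<in>Sub A. X \<subseteq> Y \<longleftrightarrow> F X \<subseteq> F Y"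
    using iso by (auto simp: lattice_isomorphic_def)
  interpret L: sub_lattice_iso "total_op A" "carrier A" M.deg "total_op T" "carrier T" F
    by unfold_locales (use F cT.total_op_closed in \<open>auto simp: subs_total_op\<close>)
  obtain \<phi> where \<phi>: "bij_betw \<phi> (carrier A) (carrier T)"
    "\<And>X. X \<subseteq> carrier A \<Longrightarrow> gen (total_op T) (\<phi> ` X) = \<phi> ` gen (total_op A) X"
    using L.induced_bijection by blast
  interpret O: orthodox_iso "total_op A" "carrier A" M.deg "total_op T" "carrier T" \<phi> a b
    by unfold_locales (use \<phi> ab M.gen_ab M.aba M.bab in auto)
  let ?c = "\<phi> a" and ?d = "\<phi> b"
  have cd: "?c \<in> carrier T" "?d \<in> carrier T" by simp_all
  have inv: "mutually_inverse T ?c ?d" using O.image_inverse cT.mutually_inverse_total_op[OF cd] by blast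
  have gen_cd: "generated T {?c, ?d} = carrier T"
    using O.gen_ab_T cT.gen_total_op[of "{?c, ?d}"] cd by simp
  have inf_cd: "infinite_order T ?c" "infinite_order T ?d"
    using O.infinite_T[OF cd(1)] O.infinite_T[OF cd(2)] cT.infinite_order_gen cd by auto
  \<comment> \<open>The two generators are regular, and regularity passes to products because the
    idempotents of \<open>T\<close> are closed.\<close>
  have "\<exists>x'\<in>carrier T. x \<cdot>\<^bsub>T\<^esub> x' \<cdot>\<^bsub>T\<^esub> x = x" if x: "x \<in> carrier T" for x
  proof -
    have "\<exists>t'\<in>carrier T. total_op T (total_op T t t') t = t" if "t \<in> {?c, ?d}" for t
      using that O.image_inverse cd by auto
    then obtain x' where "x' \<in> carrier T" "total_op T (total_op T x x') x = x"
      using O.T.regular_gen[of "{?c, ?d}" x] O.gen_ab_T cd x by auto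
    then show ?thesis using x cT.closed by (auto simp: total_op_eq)
  qed
  then have "regular_semigroup T" using T by (simp add: regular_semigroup_def)
  moreover have "subsemigroup T {e. idempotent T e}"
  proof -
    have "idempotent T (e \<cdot>\<^bsub>T\<^esub> f)" if "idempotent T e" "idempotent T f" for e f
    proof -
      have ef: "e \<in> carrier T" "f \<in> carrier T" using that by (auto simp: idempotent_def)
      then have "total_op T e f \<in> O.T.E" using that cT.idempotent_total_op by (intro O.T.E_mult) (auto simp: O.T.E_iff)
      then show ?thesis using ef cT.idempotent_total_op O.T.E_iff by (metis total_op_eq)
    qed
    then show ?thesis by (auto simp: subsemigroup_def idempotent_def)
  qed
  ultimately have "monogenic_orthodox_with T ?c ?d"
    using inv gen_cd by (simp add: monogenic_orthodox_with_def orthodox_semigroup_def)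
  moreover have "torsion_free T"
    unfolding torsion_free_def using O.infinite_T O.dl_0 cT.infinite_order_gen cT.idempotent_total_op by metis
  ultimately show "torsion_free T \<and>
      (\<exists>c d. monogenic_orthodox_with T c d \<and> infinite_order T c \<and> infinite_order T d)"
    using inf_cd by blast
qed

theorem proposition3p8:
  shows "(\<forall>(A :: 'a magma) a b. monogenic_orthodox_with A a b \<and> infinite_order A a \<longrightarrow>
            infinite_order A b \<and> torsion_free A \<and>
            (\<forall>T :: 'b magma. carrier_semigroup T \<and> lattice_isomorphic A T \<longrightarrow>
               torsion_free T \<and> monogenic_orthodox T)) \<and>
         (\<forall>(S :: 'a magma) (T :: 'b magma). monogenic_orthodox_inf S \<and> carrier_semigroup T \<and>
            lattice_isomorphic S T \<longrightarrow> monogenic_orthodox_inf T) \<and>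
         (\<forall>S :: 'a magma. monogenic_orthodox_inf S \<longrightarrow> torsion_free S)"
proof (intro conjI allI impI)
  fix A :: "'a magma" and a b
  assume A: "monogenic_orthodox_with A a b \<and> infinite_order A a"
  note iso = monogenic_orthodox_isomorphic[OF conjunct1[OF A] conjunct2[OF A]]
  show "infinite_order A b" "torsion_free A" by (rule iso)+
  fix T :: "'b magma"
  assume "carrier_semigroup T \<and> lattice_isomorphic A T"
  then show "torsion_free T" "monogenic_orthodox T"
    using iso(3)[of T] by (auto simp: monogenic_orthodox_def)
next
  fix S :: "'a magma" and T :: "'b magma"
  assume S: "monogenic_orthodox_inf S \<and> carrier_semigroup T \<and> lattice_isomorphic S T"
  then obtain a b where "monogenic_orthodox_with S a b" "infinite_order S a"
    by (auto simp: monogenic_orthodox_inf_def)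
  from monogenic_orthodox_isomorphic(3)[OF this, of T] S show "monogenic_orthodox_inf T"
    by (auto simp: monogenic_orthodox_inf_def)
next
  fix S :: "'a magma"
  assume "monogenic_orthodox_inf S"
  then obtain a b where "monogenic_orthodox_with S a b" "infinite_order S a"
    by (auto simp: monogenic_orthodox_inf_def)
  then show "torsion_free S" by (rule monogenic_orthodox_isomorphic(2))
qed

end
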